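(* Let $\boldsymbol\varphi:[0,L]\times[t_1,t_2]\to\mathbb R^3$ and $\mathbf R:[0,L]\times[t_1,t_2]\to SO(3)$ be smooth, with associated velocity $\boldsymbol v$, spin $\boldsymbol\omega$, strain-vector $\boldsymbol\varepsilon$ and curvature $\boldsymbol\kappa$, and let $$\mathcal S=\int_{t_1}^{t_2}\int_0^L\left(\tfrac12\langle\boldsymbol v,\mathbb A\boldsymbol v\rangle+\tfrac12\langle\boldsymbol\omega,\mathbb J\boldsymbol\omega\rangle-\tfrac12\langle\boldsymbol\varepsilon,\mathbb G\boldsymbol\varepsilon\rangle-\tfrac12\langle\boldsymbol\kappa,\mathbb H\boldsymbol\kappa\rangle\right)dS\,dt .$$ Then Hamilton's principle, i.e. $\delta\mathcal S=0$ for all smooth variations $(\delta\boldsymbol\varphi,\delta\boldsymbol\theta)$ that vanish at $t=t_1$ and $t=t_2$ and satisfy $\langle\delta\boldsymbol\varphi,\mathbb G\boldsymbol\varepsilon\rangle=\langle\delta\boldsymbol\theta,\mathbb H\boldsymbol\kappa\rangle=0$ at $S=0$ and $S=L$ at every time, is equivalent to the strong formulation $$\frac{\partial(\mathbb G\boldsymbol\varepsilon)}{\partial S}=\frac{\partial(\mathbb A\boldsymbol v)}{\partial t},\qquad \frac{\partial(\mathbb H\boldsymbol\kappa)}{\partial S}+\frac{\partial\boldsymbol\varphi}{\partial S}\wedge(\mathbb G\boldsymbol\varepsilon)=\frac{\partial(\mathbb J\boldsymbol\omega)}{\partial t}.$$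
   Context: $\langle\cdot,\cdot\rangle$ denotes the Euclidean scalar product on $\mathbb R^3$ and $\wedge$ the cross product. $(\boldsymbol e_1,\boldsymbol e_2,\boldsymbol e_3)$ is a fixed positively oriented orthonormal basis, identified with the canonical basis of $\mathbb R^3$. The moving frame is $\boldsymbol d_i(S,t)=\mathbf R(S,t)\boldsymbol e_i$. A bold vector $\boldsymbol u=u_i\boldsymbol d_i$ is a vector of the ambient $\mathbb R^3$; the column $u=(u_1,u_2,u_3)^T=\mathbf R^{-1}\boldsymbol u$ is its column of moving-frame components. Partial derivatives of bold vectors are those of $\mathbb R^3$-valued functions (the frame is differentiated too). The map $j:so(3)\to\mathbb R^3$ sends a skew matrix $A$ to the column $a$ with $Ax=a\wedge x$ for all $x$. The curvature $\boldsymbol\kappa$ is the bold vector with moving components $j(\mathbf R^{-1}\partial_S\mathbf R)$ and the spin $\boldsymbol\omega$ is the bold vector with moving components $j(\mathbf R^{-1}\partial_t\mathbf R)$. Moreover $\boldsymbol\varepsilon:=\partial_S\boldsymbol\varphi-\boldsymbol d_3$ and $\boldsymbol v:=\partial_t\boldsymbol\varphi$. The tensors are diagonal with constant positive entries in the moving frame $\{\boldsymbol d_i\}$: $\mathbb G=\mathrm{diag}(GA,GA,EA)$, $\mathbb H=\mathrm{diag}(EI_1,EI_2,GI_3)$, $\mathbb A=\rho A\,\mathrm{Id}$, $\mathbb J=\rho\,\mathrm{diag}(I_1,I_2,I_3)$; applied to a bold vector, $\mathbb X\boldsymbol u$ is the bold vector with moving components $\mathbb X u$. Variations: for a smooth one-parameter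 family $(\boldsymbol\varphi_\nu,\mathbf R_\nu)$ with $(\boldsymbol\varphi_0,\mathbf R_0)=(\boldsymbol\varphi,\mathbf R)$, $\delta$ denotes $\frac{d}{d\nu}|_{\nu=0}$, and $\delta\boldsymbol\theta$ is the bold vector with moving components $j(\mathbf R^{-1}\delta\mathbf R)$, so that $\delta\boldsymbol d_i=\delta\boldsymbol\theta\wedge\boldsymbol d_i$. *)

theory Defs
  imports "HOL-Analysis.Analysis"
begin

(* C^k on a set D with one-sided (within D) Frechet derivatives; meant for sets such as boxes,
   closed or not, with nonempty interior, on which these derivatives are unique. *)
fun Ck_on :: "nat \<Rightarrow> 'a::real_normed_vector set \<Rightarrow> ('a \<Rightarrow> 'b::real_normed_vector) \<Rightarrow> bool" where
  "Ck_on 0 D f \<longleftrightarrow> continuous_on D f"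
| "Ck_on (Suc k) D f \<longleftrightarrow>
     (\<exists>f'. (\<forall>x\<in>D. (f has_derivative f' x) (at x within D)) \<and> (\<forall>h. Ck_on k D (\<lambda>x. f' x h)))"

definition smooth_on :: "'a::real_normed_vector set \<Rightarrow> ('a \<Rightarrow> 'b::real_normed_vector) \<Rightarrow> bool" where
  "smooth_on D f \<longleftrightarrow> (\<forall>k. Ck_on k D f)"

(* Points are pairs (S, t).  At the ends of the intervals the partial derivatives are one-sided. *)
definition partial_S :: "real \<Rightarrow> (real \<times> real \<Rightarrow> 'b::real_normed_vector) \<Rightarrow> real \<times> real \<Rightarrow> 'b" where
  "partial_S L f p = vector_derivative (\<lambda>s. f (s, snd p)) (at (fst p) within {0..L})"

definition partial_t :: "real \<Rightarrow> real \<Rightarrow> (real \<times> real \<Rightarrow> 'b::real_normed_vector) \<Rightarrow> real \<times> real \<Rightarrow> 'b" where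
  "partial_t t1 t2 f p = vector_derivative (\<lambda>t. f (fst p, t)) (at (snd p) within {t1..t2})"

definition diag3 :: "real \<Rightarrow> real \<Rightarrow> real \<Rightarrow> real^3^3" where
  "diag3 a b c = (\<chi> i j. if i = j then vector [a, b, c] $ i else 0)"

(* The axial vector of a skew-symmetric matrix; only meaningful on such matrices. *)
definition axial :: "real^3^3 \<Rightarrow> real^3" where
  "axial M = (THE a. \<forall>x. M *v x = cross3 a x)"

lemma axial_skew:
  assumes "transpose M = - M"
  shows "M *v x = cross3 (axial M) x"
proof -
  have sk: "M $ i $ j = - (M $ j $ i)" for i j
  proof -
    have "transpose M $ i $ j = (- M) $ i $ j" using assms by simp
    then show ?thesis by (simp add: transpose_def)
  qed
  have d: "M $ i $ i = 0" for i using sk[of i i] by simp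
  let ?a = "vector [M$3$2, M$1$3, M$2$1] :: real^3"
  have 1: "M *v x = cross3 ?a x" for x
    using sk[of 1 2] sk[of 2 3] sk[of 3 1]
    by (simp add: cross3_def matrix_vector_mult_def sum_3 vec_eq_iff forall_3 d algebra_simps)
  have "axial M = ?a"
    unfolding axial_def
  proof (rule the_equality)
    show "\<forall>x. M *v x = cross3 ?a x" using 1 by blast
  next
    fix b assume b: "\<forall>x. M *v x = cross3 b x"
    have "cross3 b x = cross3 ?a x" for x using 1 b by metis
    from this[of "axis 1 1"] this[of "axis 2 1"] show "b = ?a"
      by (simp add: cross3_def vec_eq_iff forall_3 axis_def)
  qed
  then show ?thesis using 1 by simp
qed

(* The ambient vector u_i d_i with components u in the moving frame d_i = Q e_i. *)
definition spatial :: "real^3^3 \<Rightarrow> real^3 \<Rightarrow> real^3" where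
  "spatial Q u = Q *v u"

(* The tensor whose matrix in the moving frame d_i = Q e_i is X, applied to an ambient vector. *)
definition tensor :: "real^3^3 \<Rightarrow> real^3^3 \<Rightarrow> real^3 \<Rightarrow> real^3" where
  "tensor X Q u = spatial Q (X *v (matrix_inv Q *v u))"

definition velocity where
  "velocity t1 t2 (phi :: real \<times> real \<Rightarrow> real^3) p = partial_t t1 t2 phi p"

definition spin where
  "spin t1 t2 (R :: real \<times> real \<Rightarrow> real^3^3) p =
     spatial (R p) (axial (matrix_inv (R p) ** partial_t t1 t2 R p))"

definition strain where
  "strain L (phi :: real \<times> real \<Rightarrow> real^3) (R :: real \<times> real \<Rightarrow> real^3^3) p =
     partial_S L phi p - R p *v axis 3 1"

definition curvature where
  "curvature L (R :: real \<times> real \<Rightarrow> real^3^3) p =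
     spatial (R p) (axial (matrix_inv (R p) ** partial_S L R p))"

definition linear_momentum where
  "linear_momentum t1 t2 AA phi R p = tensor AA (R p) (velocity t1 t2 phi p)"

definition angular_momentum where
  "angular_momentum t1 t2 JJ R p = tensor JJ (R p) (spin t1 t2 R p)"

definition stress where
  "stress L GG phi R p = tensor GG (R p) (strain L phi R p)"

definition couple where
  "couple L HH R p = tensor HH (R p) (curvature L R p)"

definition action where
  "action L t1 t2 GG HH AA JJ phi R =
     integral {t1..t2} (\<lambda>t. integral {0..L} (\<lambda>s.
         1/2 * (velocity t1 t2 phi (s, t) \<bullet> linear_momentum t1 t2 AA phi R (s, t))
       + 1/2 * (spin t1 t2 R (s, t) \<bullet> angular_momentum t1 t2 JJ R (s, t))
       - 1/2 * (strain L phi R (s, t) \<bullet> stress L GG phi R (s, t))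
       - 1/2 * (curvature L R (s, t) \<bullet> couple L HH R (s, t))))"

definition smooth_family where
  "smooth_family L t1 t2 a phi R (Phi :: real \<Rightarrow> real \<times> real \<Rightarrow> real^3)
       (Q :: real \<Rightarrow> real \<times> real \<Rightarrow> real^3^3) \<longleftrightarrow>
     0 < a \<and>
     smooth_on ({-a<..<a} \<times> ({0..L} \<times> {t1..t2})) (\<lambda>(nu, p). Phi nu p) \<and>
     smooth_on ({-a<..<a} \<times> ({0..L} \<times> {t1..t2})) (\<lambda>(nu, p). Q nu p) \<and>
     (\<forall>nu\<in>{-a<..<a}. \<forall>p\<in>{0..L} \<times> {t1..t2}. rotation_matrix (Q nu p)) \<and>
     (\<forall>p\<in>{0..L} \<times> {t1..t2}. Phi 0 p = phi p \<and> Q 0 p = R p)"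

definition delta :: "(real \<Rightarrow> real \<times> real \<Rightarrow> 'b::real_normed_vector) \<Rightarrow> real \<times> real \<Rightarrow> 'b" where
  "delta F p = vector_derivative (\<lambda>nu. F nu p) (at 0)"

definition delta_theta where
  "delta_theta (R :: real \<times> real \<Rightarrow> real^3^3) Q p =
     spatial (R p) (axial (matrix_inv (R p) ** delta Q p))"

definition admissible_variation where
  "admissible_variation L t1 t2 GG HH phi R Phi Q \<longleftrightarrow>
     (\<forall>s\<in>{0..L}. \<forall>t\<in>{t1, t2}. delta Phi (s, t) = 0 \<and> delta_theta R Q (s, t) = 0) \<and>
     (\<forall>s\<in>{0, L}. \<forall>t\<in>{t1..t2}.
        delta Phi (s, t) \<bullet> stress L GG phi R (s, t) = 0 \<and>
        delta_theta R Q (s, t) \<bullet> couple L HH R (s, t) = 0)"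

definition hamilton_principle where
  "hamilton_principle L t1 t2 GG HH AA JJ phi R \<longleftrightarrow>
     (\<forall>a Phi Q. smooth_family L t1 t2 a phi R Phi Q \<longrightarrow>
        admissible_variation L t1 t2 GG HH phi R Phi Q \<longrightarrow>
        ((\<lambda>nu. action L t1 t2 GG HH AA JJ (Phi nu) (Q nu)) has_real_derivative 0) (at 0))"

end

theory Submission
  imports Defs
begin

text \<open>In moving-frame components, let \<open>K\<close>, \<open>W\<close> and \<open>\<eta>\<close> be the axial vectors of \<open>R\<^sup>T R\<^sub>S\<close>, \<open>R\<^sup>T R\<^sub>t\<close>
  and \<open>R\<^sup>T \<delta>R\<close>. Since mixed partial derivatives commute, \<open>\<delta>K = \<eta>\<^sub>S + K \<times> \<eta>\<close> and \<open>\<delta>W = \<eta>\<^sub>t + W \<times> \<eta>\<close>.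
  Hence the variation of the Lagrangian density is a divergence, whose boundary contributions vanish for
  admissible variations, plus the work of \<open>\<delta>\<phi>\<close> and \<open>\<delta>\<theta>\<close> against the defects of the two equations of
  motion. Conversely the defects are themselves smooth up to the boundary, so no compactly supported test
  functions are needed: with a polynomial \<open>b\<close> that is positive inside the rectangle and zero on its
  boundary, the variations \<open>\<delta>\<phi> = b F\<close> and, for each frame component \<open>i\<close>, \<open>\<delta>\<theta> = b m\<^sub>i d\<^sub>i\<close>
  (a rotation of the frame about its \<open>i\<close>-th axis) turn \<open>\<delta>S = 0\<close> into \<open>\<integral> b \<bar>F\<bar>\<^sup>2 = 0\<close> and
  \<open>\<integral> b m\<^sub>i\<^sup>2 = 0\<close>.\<close>

section \<open>Smooth maps\<close>

lemma Ck_on_Suc_imp: "Ck_on (Suc k) D f \<Longrightarrow> Ck_on k D f"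
proof (induction k arbitrary: f)
  case 0
  then show ?case by (auto intro: has_derivative_continuous_on)
next
  case (Suc k)
  then show ?case by (metis Ck_on.simps(2))
qed

lemma Ck_on_cong: "(\<And>x. x \<in> D \<Longrightarrow> f x = g x) \<Longrightarrow> Ck_on k D f \<Longrightarrow> Ck_on k D g"
proof (cases k)
  case (Suc n)
  assume "\<And>x. x \<in> D \<Longrightarrow> f x = g x" "Ck_on k D f"
  then show ?thesis
    unfolding Suc Ck_on.simps by (metis has_derivative_transform)
qed (auto cong: continuous_on_cong)

lemma Ck_on_const: "Ck_on k D (\<lambda>x. c)"
proof (induction k arbitrary: c)
  case (Suc k)
  then show ?case by (auto intro!: exI[of _ "\<lambda>x h. 0"])
qed auto

lemma Ck_on_bounded_linear:
  assumes "bounded_linear l" shows "Ck_on k D f \<Longrightarrow> Ck_on k D (\<lambda>x. l (f x))"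
proof (induction k arbitrary: f)
  case 0
  then show ?case using assms by (simp add: bounded_linear.continuous_on)
next
  case (Suc k)
  then obtain f' where "\<forall>x\<in>D. (f has_derivative f' x) (at x within D)" "\<forall>h. Ck_on k D (\<lambda>x. f' x h)"
    by auto
  then have "\<forall>x\<in>D. ((\<lambda>x. l (f x)) has_derivative (\<lambda>h. l (f' x h))) (at x within D)"
    "\<forall>h. Ck_on k D (\<lambda>x. l (f' x h))"
    using Suc.IH by (auto intro: bounded_linear.has_derivative[OF assms])
  then show ?case by (auto intro!: exI[of _ "\<lambda>x h. l (f' x h)"])
qed

lemma Ck_on_add: "Ck_on k D f \<Longrightarrow> Ck_on k D g \<Longrightarrow> Ck_on k D (\<lambda>x. f x + g x)"
proof (induction k arbitrary: f g)
  case (Suc k)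
  then obtain f' g' where "\<forall>x\<in>D. (f has_derivative f' x) (at x within D)" "\<forall>h. Ck_on k D (\<lambda>x. f' x h)"
     "\<forall>x\<in>D. (g has_derivative g' x) (at x within D)" "\<forall>h. Ck_on k D (\<lambda>x. g' x h)"
    by auto
  then show ?case
    using Suc.IH by (auto intro!: exI[of _ "\<lambda>x h. f' x h + g' x h"] has_derivative_add)
qed (auto intro: continuous_on_add)

text \<open>Induction by the product rule: each directional derivative is a sum of two products, to
  which the induction hypothesis applies once the undifferentiated factor is lowered by one order.
  Matrix, cross, inner and scalar products are all instances.\<close>

lemma Ck_on_bounded_bilinear:
  assumes "bounded_bilinear pr"
  shows "Ck_on k D f \<Longrightarrow> Ck_on k D g \<Longrightarrow> Ck_on k D (\<lambda>x. pr (f x) (g x))"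
proof (induction k arbitrary: f g)
  case 0
  then show ?case using assms by (auto intro: bounded_bilinear.continuous_on)
next
  case (Suc k)
  then obtain f' g' where f': "\<forall>x\<in>D. (f has_derivative f' x) (at x within D)" "\<forall>h. Ck_on k D (\<lambda>x. f' x h)"
     and g': "\<forall>x\<in>D. (g has_derivative g' x) (at x within D)" "\<forall>h. Ck_on k D (\<lambda>x. g' x h)"
    by auto
  have "\<forall>h. Ck_on k D (\<lambda>x. pr (f x) (g' x h) + pr (f' x h) (g x))"
    using f'(2) g'(2) Suc.prems[THEN Ck_on_Suc_imp] by (intro allI Ck_on_add Suc.IH) auto
  then show ?case
    using f'(1) g'(1)
    by (auto intro!: exI[of _ "\<lambda>x h. pr (f x) (g' x h) + pr (f' x h) (g x)"]
        bounded_bilinear.FDERIV[OF assms])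
qed

text \<open>For linear \<open>l\<close> and a fixed \<open>h\<close>, the derivative is that of
  \<open>f\<close> in the fixed direction \<open>l h\<close>, composed with \<open>l\<close> again,
  so the induction closes.\<close>

lemma Ck_on_compose_linear:
  assumes l: "bounded_linear l" and "l ` E \<subseteq> D"
  shows "Ck_on k D f \<Longrightarrow> Ck_on k E (\<lambda>x. f (l x))"
proof (induction k arbitrary: f)
  case 0
  then show ?case using assms by (auto intro: continuous_on_compose2 linear_continuous_on)
next
  case (Suc k)
  then obtain f' where f': "\<forall>x\<in>D. (f has_derivative f' x) (at x within D)" "\<forall>h. Ck_on k D (\<lambda>x. f' x h)"
    by auto
  have "((\<lambda>x. f (l x)) has_derivative (\<lambda>h. f' (l x) (l h))) (at x within E)" if "x \<in> E" for x
    using f'(1) assms(2) that bounded_linear_imp_has_derivative[OF l, of "at x within E"]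
    by (intro has_derivative_in_compose2[of D f f' l E x l]) auto
  then show ?case using Suc.IH f'(2) by (auto intro!: exI[of _ "\<lambda>x h. f' (l x) (l h)"])
qed

text \<open>Sine and cosine go through the induction together because each appears in the derivative
  of the other.\<close>

lemma Ck_on_sin_cos:
  fixes f :: "'a::real_normed_vector \<Rightarrow> real"
  shows "Ck_on k D f \<Longrightarrow> Ck_on k D (\<lambda>x. sin (f x)) \<and> Ck_on k D (\<lambda>x. cos (f x))"
proof (induction k arbitrary: f)
  case 0
  then show ?case by (auto intro!: continuous_intros)
next
  case (Suc k)
  then obtain f' where f': "\<forall>x\<in>D. (f has_derivative f' x) (at x within D)" "\<forall>h. Ck_on k D (\<lambda>x. f' x h)"
    by auto
  have sc: "Ck_on k D (\<lambda>x. sin (f x))" "Ck_on k D (\<lambda>x. cos (f x))"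
    using Suc Ck_on_Suc_imp by blast+
  have "Ck_on k D (\<lambda>x. f' x h * cos (f x))" "Ck_on k D (\<lambda>x. f' x h * - sin (f x))" for h
    using Ck_on_bounded_bilinear[OF bounded_bilinear_mult] sc f'(2)
      Ck_on_bounded_linear[OF bounded_linear_minus[OF bounded_linear_ident]] by blast+
  moreover have "\<forall>x\<in>D. ((\<lambda>x. sin (f x)) has_derivative (\<lambda>h. f' x h * cos (f x))) (at x within D)"
     "\<forall>x\<in>D. ((\<lambda>x. cos (f x)) has_derivative (\<lambda>h. f' x h * - sin (f x))) (at x within D)"
    using f'(1) by (auto intro!: derivative_eq_intros)
  ultimately show ?case by (auto simp del: mult_minus_right)
qed

lemma smooth_on_cong: "(\<And>x. x \<in> D \<Longrightarrow> f x = g x) \<Longrightarrow> smooth_on D f \<Longrightarrow> smooth_on D g"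
  unfolding smooth_on_def using Ck_on_cong by blast

lemma smooth_on_const: "smooth_on D (\<lambda>x. c)"
  by (simp add: smooth_on_def Ck_on_const)

lemma smooth_on_bounded_linear: "bounded_linear l \<Longrightarrow> smooth_on D f \<Longrightarrow> smooth_on D (\<lambda>x. l (f x))"
  by (simp add: smooth_on_def Ck_on_bounded_linear)

lemma smooth_on_add: "smooth_on D f \<Longrightarrow> smooth_on D g \<Longrightarrow> smooth_on D (\<lambda>x. f x + g x)"
  by (simp add: smooth_on_def Ck_on_add)

lemma smooth_on_bounded_bilinear:
  "bounded_bilinear pr \<Longrightarrow> smooth_on D f \<Longrightarrow> smooth_on D g \<Longrightarrow> smooth_on D (\<lambda>x. pr (f x) (g x))"
  by (simp add: smooth_on_def Ck_on_bounded_bilinear)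

lemma smooth_on_compose_linear:
  "bounded_linear l \<Longrightarrow> l ` E \<subseteq> D \<Longrightarrow> smooth_on D f \<Longrightarrow> smooth_on E (\<lambda>x. f (l x))"
  unfolding smooth_on_def using Ck_on_compose_linear by blast

lemma smooth_on_subset: "smooth_on D f \<Longrightarrow> E \<subseteq> D \<Longrightarrow> smooth_on E f"
  using smooth_on_compose_linear[OF bounded_linear_ident] by auto

lemma smooth_on_linear: "bounded_linear l \<Longrightarrow> smooth_on D l"
proof -
  assume l: "bounded_linear l"
  have "Ck_on k D l" for k
  proof (cases k)
    case (Suc n)
    then show ?thesis using l
      by (auto intro!: exI[of _ "\<lambda>x. l"] Ck_on_const bounded_linear_imp_has_derivative)
  qed (use l in \<open>auto intro: linear_continuous_on\<close>)
  then show ?thesis by (simp add: smooth_on_def)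
qed

lemma smooth_on_diff: "smooth_on D f \<Longrightarrow> smooth_on D g \<Longrightarrow> smooth_on D (\<lambda>x. f x - g x)"
  using smooth_on_add[OF _ smooth_on_bounded_linear[OF bounded_linear_minus[OF bounded_linear_ident]], of D f g]
  by simp

lemma smooth_on_sin: "smooth_on D f \<Longrightarrow> smooth_on D (\<lambda>x. sin (f x :: real))"
  and smooth_on_cos: "smooth_on D f \<Longrightarrow> smooth_on D (\<lambda>x. cos (f x :: real))"
  by (simp_all add: smooth_on_def Ck_on_sin_cos)

lemma smooth_on_continuous_on: "smooth_on D f \<Longrightarrow> continuous_on D f"
  unfolding smooth_on_def by (metis Ck_on.simps(1))

section \<open>Matrix and vector operations as bounded (bi)linear maps\<close>

lemma bounded_bilinear_matrix_mult:
  "bounded_bilinear ((**) :: real^'n^'m \<Rightarrow> real^'p^'n \<Rightarrow> real^'p^'m)"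
  unfolding bilinear_conv_bounded_bilinear[symmetric]
  by (auto simp: bilinear_def linear_iff matrix_matrix_mult_def vec_eq_iff sum.distrib algebra_simps
      sum_distrib_left)

lemma bounded_bilinear_matrix_vector_mult:
  "bounded_bilinear ((*v) :: real^'n^'m \<Rightarrow> real^'n \<Rightarrow> real^'m)"
  unfolding bilinear_conv_bounded_bilinear[symmetric]
  by (auto simp: bilinear_def linear_iff matrix_vector_mult_def vec_eq_iff sum.distrib algebra_simps
      sum_distrib_left)

lemma bounded_bilinear_cross3: "bounded_bilinear cross3"
  by (simp add: bilinear_conv_bounded_bilinear[symmetric] bilinear_cross)

lemma bounded_linear_transpose: "bounded_linear (transpose :: real^'n^'m \<Rightarrow> real^'m^'n)"
  by (simp add: linear_conv_bounded_linear[symmetric] linear_iff transpose_def vec_eq_iff)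

lemmas smooth_intros =
  smooth_on_const smooth_on_add smooth_on_diff
  smooth_on_bounded_linear[OF bounded_linear_transpose]
  smooth_on_bounded_linear[OF bounded_linear_vec_nth]
  smooth_on_bounded_bilinear[OF bounded_bilinear_matrix_mult]
  smooth_on_bounded_bilinear[OF bounded_bilinear_matrix_vector_mult]
  smooth_on_bounded_bilinear[OF bounded_bilinear_cross3]
  smooth_on_bounded_bilinear[OF bounded_bilinear_inner]
  smooth_on_bounded_bilinear[OF bounded_bilinear_mult]
  smooth_on_bounded_bilinear[OF bounded_bilinear_scaleR]
  smooth_on_sin smooth_on_cos

section \<open>Calculus on the parameter box\<close>

text \<open>Obtained by differentiating the fundamental theorem of calculus in \<open>y\<close> under the integral
  sign, hence valid with one-sided derivatives up to the boundary.\<close>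
lemma mixed_derivatives_eq:
  fixes f :: "real \<Rightarrow> real \<Rightarrow> 'b::euclidean_space"
  assumes "a < b" "c < e"
    and fx: "\<And>x y. x \<in> {a..b} \<Longrightarrow> y \<in> {c..e} \<Longrightarrow> ((\<lambda>x. f x y) has_vector_derivative fx x y) (at x within {a..b})"
    and fy: "\<And>x y. x \<in> {a..b} \<Longrightarrow> y \<in> {c..e} \<Longrightarrow> ((\<lambda>y. f x y) has_vector_derivative fy x y) (at y within {c..e})"
    and fyx: "\<And>x y. x \<in> {a..b} \<Longrightarrow> y \<in> {c..e} \<Longrightarrow> ((\<lambda>x. fy x y) has_vector_derivative fyx x y) (at x within {a..b})"
    and fxy: "\<And>x y. x \<in> {a..b} \<Longrightarrow> y \<in> {c..e} \<Longrightarrow> ((\<lambda>y. fx x y) has_vector_derivative fxy x y) (at y within {c..e})"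
    and cont: "continuous_on ({a..b} \<times> {c..e}) (\<lambda>(x, y). fy x y)"
      "continuous_on ({a..b} \<times> {c..e}) (\<lambda>(x, y). fyx x y)"
    and x: "x \<in> {a..b}" and y: "y \<in> {c..e}"
  shows "fxy x y = fyx x y"
proof -
  have c1: "continuous_on {c..y} (fy x)" if "x \<in> {a..b}" "y \<in> {c..e}" for x y
    using that by (auto intro!: continuous_on_compose2[OF cont(1), of _ "\<lambda>y. (x, y)", simplified] continuous_intros)
  have c2: "continuous_on {c..e} (fyx x)" if "x \<in> {a..b}" for x
    using that by (auto intro!: continuous_on_compose2[OF cont(2), of _ "\<lambda>y. (x, y)", simplified] continuous_intros)
  have ftc: "f x y = f x c + integral {c..y} (fy x)" if "x \<in> {a..b}" "y \<in> {c..e}" for x y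
  proof -
    have "(fy x has_integral f x y - f x c) {c..y}"
    proof (rule fundamental_theorem_of_calculus)
      show "((\<lambda>y. f x y) has_vector_derivative fy x z) (at z within {c..y})" if "z \<in> {c..y}" for z
        by (rule has_vector_derivative_within_subset[OF fy]) (use that \<open>x \<in> {a..b}\<close> \<open>y \<in> {c..e}\<close> in auto)
    qed (use that in auto)
    from integral_unique[OF this] show ?thesis by simp
  qed
  have fx_eq: "fx x y = fx x c + integral {c..y} (fyx x)" if "y \<in> {c..e}" for y
  proof -
    have leib: "((\<lambda>x. integral (cbox c y) (fy x)) has_vector_derivative integral (cbox c y) (fyx x)) (at x within {a..b})"
    proof (rule leibniz_rule_vector_derivative)
      show "continuous_on ({a..b} \<times> cbox c y) (\<lambda>(x, t). fyx x t)"
        using that by (intro continuous_on_subset[OF cont(2)]) auto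
    qed (use that x in \<open>auto intro!: fyx integrable_continuous_real c1\<close>)
    have "((\<lambda>x. f x c + integral {c..y} (fy x)) has_vector_derivative fx x c + integral {c..y} (fyx x)) (at x within {a..b})"
      using has_vector_derivative_add[OF fx leib] x \<open>c < e\<close> by simp
    then have "((\<lambda>x. f x y) has_vector_derivative fx x c + integral {c..y} (fyx x)) (at x within {a..b})"
      by (rule has_vector_derivative_transform[OF x, rotated]) (rule ftc[OF _ that])
    then show ?thesis
      using vector_derivative_unique_within_closed_interval[of a b x "\<lambda>x. f x y"] fx[OF x that] x \<open>a < b\<close> by simp
  qed
  \<comment> \<open>The \<open>x\<close>-derivative is now an integral with variable upper limit,
    whose one-sided derivative in \<open>y\<close> is the integrand.\<close>
  have "((\<lambda>y. fx x c + integral {c..y} (fyx x)) has_vector_derivative fyx x y) (at y within {c..e})"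
    using has_vector_derivative_add[OF has_vector_derivative_const integral_has_vector_derivative[OF c2[OF x] y], of "fx x c"]
    by simp
  then have "((\<lambda>y. fx x y) has_vector_derivative fyx x y) (at y within {c..e})"
    by (rule has_vector_derivative_transform[OF y, rotated]) (rule fx_eq)
  then show ?thesis
    using vector_derivative_unique_within_closed_interval[of c e y "\<lambda>y. fx x y"] fxy[OF x y] y \<open>c < e\<close> by simp
qed

text \<open>Points are triples of the variation parameter, \<open>S\<close> and \<open>t\<close>, in this order.\<close>
locale parameter_box =
  fixes al L t1 t2 :: real
  assumes al: "0 < al" and L: "0 < L" and t12: "t1 < t2"
begin

section \<open>Directional derivatives within the closed box\<close>

definition C :: "(real \<times> real \<times> real) set" where "C = {-al..al} \<times> ({0..L} \<times> {t1..t2})"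

text \<open>The direction comes before the function, so that \<open>dd h f\<close> is again a field
  on the box and can be differentiated further. Taken within \<open>C\<close>, the derivative is
  one-sided on the faces.\<close>

definition dd :: "real \<times> real \<times> real \<Rightarrow> (real \<times> real \<times> real \<Rightarrow> 'b::real_normed_vector) \<Rightarrow> real \<times> real \<times> real \<Rightarrow> 'b" where
  "dd h f x = frechet_derivative f (at x within C) h"

abbreviation "sm \<equiv> smooth_on C"
abbreviation "eN \<equiv> (1::real, 0::real, 0::real)"
abbreviation "eS \<equiv> (0::real, 1::real, 0::real)"
abbreviation "eT \<equiv> (0::real, 0::real, 1::real)"

lemma C_cbox: "C = cbox (-al, 0, t1) (al, L, t2)"
  by (simp add: C_def cbox_Pair_eq)

lemma C_iff: "(n, s, t) \<in> C \<longleftrightarrow> n \<in> {-al..al} \<and> s \<in> {0..L} \<and> t \<in> {t1..t2}"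
  by (auto simp: C_def)

text \<open>The box has positive length in every coordinate, which determines the derivative even on
  faces and at corners.\<close>

lemma has_derivative_C_unique:
  assumes "x \<in> C" "(f has_derivative f') (at x within C)" "(f has_derivative g') (at x within C)"
  shows "f' = g'"
proof (rule frechet_derivative_unique_within_closed_interval)
  show "(-al, 0, t1) \<bullet> i < (al, L, t2) \<bullet> i" if "i \<in> Basis" for i
    using that al L t12 by (auto simp: Basis_prod_def)
qed (use assms C_cbox in auto)

lemma dd_eqI:
  assumes "(f has_derivative f') (at x within C)" "x \<in> C"
  shows "dd h f x = f' h"
  using has_derivative_C_unique[OF assms(2,1), of "frechet_derivative f (at x within C)"] assms(1)
  unfolding dd_def by (metis differentiableI frechet_derivative_works)

lemma has_derivative_dd:
  assumes "sm f" "x \<in> C"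
  shows "(f has_derivative (\<lambda>h. dd h f x)) (at x within C)"
proof -
  have "Ck_on (Suc 0) C f" using assms(1) unfolding smooth_on_def by blast
  with assms(2) show ?thesis unfolding dd_def
    by (metis Ck_on.simps(2) differentiableI frechet_derivative_works)
qed

text \<open>The derivative witnessing order \<open>Suc k\<close> might depend on \<open>k\<close>;
  uniqueness within \<open>C\<close> identifies each such witness with \<open>dd\<close>.\<close>

lemma smooth_dd: assumes "sm f" shows "sm (dd h f)"
  unfolding smooth_on_def
proof
  fix k
  have "Ck_on (Suc k) C f" using assms unfolding smooth_on_def by blast
  then obtain f' where f': "\<forall>x\<in>C. (f has_derivative f' x) (at x within C)" "Ck_on k C (\<lambda>x. f' x h)"
    unfolding Ck_on.simps by blast
  show "Ck_on k C (dd h f)"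
    by (rule Ck_on_cong[OF _ f'(2)]) (use dd_eqI f'(1) in metis)
qed

lemma dd_cong: "(\<And>x. x \<in> C \<Longrightarrow> f x = g x) \<Longrightarrow> sm f \<Longrightarrow> x \<in> C \<Longrightarrow> dd h f x = dd h g x"
  by (rule dd_eqI[OF _, symmetric]) (auto intro: has_derivative_transform[OF _ _ has_derivative_dd])

lemma dd_const: "x \<in> C \<Longrightarrow> dd h (\<lambda>x. c) x = 0"
  by (rule dd_eqI[where f' = "\<lambda>h. 0"]) auto

lemma dd_add: "sm f \<Longrightarrow> sm g \<Longrightarrow> x \<in> C \<Longrightarrow> dd h (\<lambda>x. f x + g x) x = dd h f x + dd h g x"
  by (rule dd_eqI[where f' = "\<lambda>h. dd h f x + dd h g x"]) (auto intro!: has_derivative_add has_derivative_dd)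

lemma dd_diff: "sm f \<Longrightarrow> sm g \<Longrightarrow> x \<in> C \<Longrightarrow> dd h (\<lambda>x. f x - g x) x = dd h f x - dd h g x"
  by (rule dd_eqI[where f' = "\<lambda>h. dd h f x - dd h g x"]) (auto intro!: has_derivative_diff has_derivative_dd)

lemma dd_linear: "bounded_linear l \<Longrightarrow> sm f \<Longrightarrow> x \<in> C \<Longrightarrow> dd h (\<lambda>x. l (f x)) x = l (dd h f x)"
  by (rule dd_eqI[where f' = "\<lambda>h. l (dd h f x)"]) (rule bounded_linear.has_derivative has_derivative_dd | assumption)+

lemma dd_bilinear:
  assumes "bounded_bilinear pr"
  shows "sm f \<Longrightarrow> sm g \<Longrightarrow> x \<in> C \<Longrightarrow> dd h (\<lambda>x. pr (f x) (g x)) x = pr (f x) (dd h g x) + pr (dd h f x) (g x)"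
  by (rule dd_eqI[where f' = "\<lambda>h. pr (f x) (dd h g x) + pr (dd h f x) (g x)"])
    (rule bounded_bilinear.FDERIV[OF assms] has_derivative_dd | assumption)+

lemmas dd_simps = dd_const dd_add dd_diff
  dd_linear[OF bounded_linear_transpose]
  dd_bilinear[OF bounded_bilinear_matrix_mult]
  dd_bilinear[OF bounded_bilinear_matrix_vector_mult]
  dd_bilinear[OF bounded_bilinear_cross3]
  dd_bilinear[OF bounded_bilinear_inner]
  dd_bilinear[OF bounded_bilinear_mult]
  dd_bilinear[OF bounded_bilinear_scaleR]

text \<open>Chain rule along an affine path that stays in the box; the three coordinate derivatives
  below are its instances.\<close>

lemma has_vector_derivative_line:
  assumes "sm f" "x \<in> C" and g: "\<And>r. g r = x + (r - r0) *\<^sub>R h" and I: "r0 \<in> I" "g ` I \<subseteq> C"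
  shows "((\<lambda>r. f (g r)) has_vector_derivative dd h f x) (at r0 within I)"
proof -
  have "(g has_derivative (\<lambda>r. r *\<^sub>R h)) (at r0 within I)"
    unfolding g[abs_def] by (auto intro!: derivative_eq_intros)
  then have "((\<lambda>r. f (g r)) has_derivative (\<lambda>r. dd (r *\<^sub>R h) f (g r0))) (at r0 within I)"
    using has_derivative_in_compose2[of C f "\<lambda>x h. dd h f x" g I r0 "\<lambda>r. r *\<^sub>R h"]
      has_derivative_dd[OF assms(1)] I by auto
  moreover have "g r0 = x" by (simp add: g)
  moreover have "dd (r *\<^sub>R h) f x = r *\<^sub>R dd h f x" for r
    using has_derivative_dd[OF assms(1,2)] has_derivative_bounded_linear bounded_linear.linear linear_scale by blast
  ultimately show ?thesis by (simp add: has_vector_derivative_def)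
qed

lemma has_vector_derivative_N:
  "sm f \<Longrightarrow> (n, s, t) \<in> C \<Longrightarrow> ((\<lambda>n. f (n, s, t)) has_vector_derivative dd eN f (n, s, t)) (at n within {-al..al})"
  by (rule has_vector_derivative_line[of f "(n,s,t)"]) (auto simp: C_iff)

lemma has_vector_derivative_S:
  "sm f \<Longrightarrow> (n, s, t) \<in> C \<Longrightarrow> ((\<lambda>s. f (n, s, t)) has_vector_derivative dd eS f (n, s, t)) (at s within {0..L})"
  by (rule has_vector_derivative_line[of f "(n,s,t)"]) (auto simp: C_iff)

lemma has_vector_derivative_T:
  "sm f \<Longrightarrow> (n, s, t) \<in> C \<Longrightarrow> ((\<lambda>t. f (n, s, t)) has_vector_derivative dd eT f (n, s, t)) (at t within {t1..t2})"
  by (rule has_vector_derivative_line[of f "(n,s,t)"]) (auto simp: C_iff)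

lemma smooth_continuous_compose:
  "sm f \<Longrightarrow> continuous_on D g \<Longrightarrow> g ` D \<subseteq> C \<Longrightarrow> continuous_on D (\<lambda>x. f (g x))"
  by (rule continuous_on_compose2[OF smooth_on_continuous_on])

section \<open>Symmetry of the mixed derivatives involving the variation parameter\<close>

lemma dd_commute_S:
  fixes f :: "_ \<Rightarrow> 'b::euclidean_space"
  assumes "sm f" "x \<in> C" shows "dd eS (dd eN f) x = dd eN (dd eS f) x"
proof -
  obtain n s t where x: "x = (n, s, t)" by (cases x)
  show ?thesis
    using assms(2) al L unfolding x
    by (intro mixed_derivatives_eq[of "-al" al 0 L "\<lambda>n s. f (n, s, t)" "\<lambda>n s. dd eN f (n, s, t)"
         "\<lambda>n s. dd eS f (n, s, t)" "\<lambda>n s. dd eN (dd eS f) (n, s, t)" "\<lambda>n s. dd eS (dd eN f) (n, s, t)"]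
        has_vector_derivative_N has_vector_derivative_S smooth_dd assms(1))
      (auto simp: C_iff split_beta assms(1) intro!: smooth_continuous_compose smooth_dd continuous_intros)
qed

lemma dd_commute_T:
  fixes f :: "_ \<Rightarrow> 'b::euclidean_space"
  assumes "sm f" "x \<in> C" shows "dd eT (dd eN f) x = dd eN (dd eT f) x"
proof -
  obtain n s t where x: "x = (n, s, t)" by (cases x)
  show ?thesis
    using assms(2) al t12 unfolding x
    by (intro mixed_derivatives_eq[of "-al" al t1 t2 "\<lambda>n t. f (n, s, t)" "\<lambda>n t. dd eN f (n, s, t)"
         "\<lambda>n t. dd eT f (n, s, t)" "\<lambda>n t. dd eN (dd eT f) (n, s, t)" "\<lambda>n t. dd eT (dd eN f) (n, s, t)"]
        has_vector_derivative_N has_vector_derivative_T smooth_dd assms(1))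
      (auto simp: C_iff split_beta assms(1) intro!: smooth_continuous_compose smooth_dd continuous_intros)
qed

section \<open>Partial derivatives and variations as directional derivatives on a slice of the
  box\<close>

lemma partial_S_slice:
  assumes "sm F" "\<And>p. p \<in> {0..L} \<times> {t1..t2} \<Longrightarrow> f p = F (n, p)"
    and "n \<in> {-al..al}" "p \<in> {0..L} \<times> {t1..t2}"
  shows "partial_S L f p = dd eS F (n, p)"
proof -
  obtain s t where p: "p = (s, t)" by (cases p)
  have "((\<lambda>s. f (s, t)) has_vector_derivative dd eS F (n, s, t)) (at s within {0..L})"
    by (rule has_vector_derivative_transform[OF _ _ has_vector_derivative_S[OF assms(1)]])
      (use assms p in \<open>auto simp: C_iff\<close>)
  then show ?thesis
    using assms(4) L by (simp add: partial_S_def p vector_derivative_within_cbox[OF L, unfolded box_real])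
qed

lemma partial_t_slice:
  assumes "sm F" "\<And>p. p \<in> {0..L} \<times> {t1..t2} \<Longrightarrow> f p = F (n, p)"
    and "n \<in> {-al..al}" "p \<in> {0..L} \<times> {t1..t2}"
  shows "partial_t t1 t2 f p = dd eT F (n, p)"
proof -
  obtain s t where p: "p = (s, t)" by (cases p)
  have "((\<lambda>t. f (s, t)) has_vector_derivative dd eT F (n, s, t)) (at t within {t1..t2})"
    by (rule has_vector_derivative_transform[OF _ _ has_vector_derivative_T[OF assms(1)]])
      (use assms p in \<open>auto simp: C_iff\<close>)
  then show ?thesis
    using assms(4) by (simp add: partial_t_def p vector_derivative_within_cbox[OF t12, unfolded box_real])
qed

text \<open>The value 0 is interior to the parameter interval, so the derivative within the box is
  two-sided there.\<close>

lemma delta_slice: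
  assumes "sm F" "\<And>n. n \<in> {-al..al} \<Longrightarrow> f n p = F (n, p)" "p \<in> {0..L} \<times> {t1..t2}"
  shows "delta f p = dd eN F (0, p)"
proof -
  obtain s t where p: "p = (s, t)" by (cases p)
  have "((\<lambda>n. f n (s, t)) has_vector_derivative dd eN F (0, s, t)) (at 0 within {-al..al})"
    by (rule has_vector_derivative_transform[OF _ _ has_vector_derivative_N[OF assms(1)]])
      (use assms al p in \<open>auto simp: C_iff\<close>)
  moreover have "at (0::real) within {-al..al} = at 0"
    using al by (intro at_within_interior) simp
  ultimately show ?thesis by (simp add: delta_def p vector_derivative_at)
qed

text \<open>Fubini, then the fundamental theorem in \<open>S\<close>: only the vanishing boundary
  values remain.\<close>

lemma integral_dd_S_eq_0:
  fixes f :: "real \<times> real \<times> real \<Rightarrow> real"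
  assumes "sm f" "n \<in> {-al..al}" "\<And>t. t \<in> {t1..t2} \<Longrightarrow> f (n, 0, t) = 0 \<and> f (n, L, t) = 0"
  shows "integral (cbox (0, t1) (L, t2)) (\<lambda>p. dd eS f (n, p)) = 0"
proof -
  have c: "continuous_on (cbox (0, t1) (L, t2)) (\<lambda>p. dd eS f (n, p))"
    using assms(2)
    by (intro smooth_continuous_compose[OF smooth_dd[OF assms(1)], of _ "\<lambda>p. (n, p)"] continuous_intros)
      (auto simp: C_def cbox_Pair_eq)
  have "integral (cbox (0, t1) (L, t2)) (\<lambda>p. dd eS f (n, p))
      = integral (cbox 0 L) (\<lambda>s. integral (cbox t1 t2) (\<lambda>t. dd eS f (n, s, t)))"
    by (rule integral_prod_continuous[OF c])
  \<comment> \<open>The product integral has \<open>S\<close> outside; the order is swapped to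
    integrate the \<open>S\<close>-derivative first.\<close>
  also have "\<dots> = integral (cbox t1 t2) (\<lambda>t. integral (cbox 0 L) (\<lambda>s. dd eS f (n, s, t)))"
    by (rule integral_swap_continuous) (use c in \<open>simp add: split_beta\<close>)
  also have "\<dots> = integral (cbox t1 t2) (\<lambda>t. 0)"
  proof (rule integral_cong)
    fix t assume t: "t \<in> cbox t1 t2"
    have "((\<lambda>s. dd eS f (n, s, t)) has_integral f (n, L, t) - f (n, 0, t)) {0..L}"
      using L t assms(1,2)
      by (intro fundamental_theorem_of_calculus has_vector_derivative_S) (auto simp: C_iff)
    then show "integral (cbox 0 L) (\<lambda>s. dd eS f (n, s, t)) = 0"
      using assms(3) t by (simp add: integral_unique)
  qed
  finally show ?thesis by simp
qed

lemma integral_dd_T_eq_0: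
  fixes f :: "real \<times> real \<times> real \<Rightarrow> real"
  assumes "sm f" "n \<in> {-al..al}" "\<And>s. s \<in> {0..L} \<Longrightarrow> f (n, s, t1) = 0 \<and> f (n, s, t2) = 0"
  shows "integral (cbox (0, t1) (L, t2)) (\<lambda>p. dd eT f (n, p)) = 0"
proof -
  have c: "continuous_on (cbox (0, t1) (L, t2)) (\<lambda>p. dd eT f (n, p))"
    using assms(2)
    by (intro smooth_continuous_compose[OF smooth_dd[OF assms(1)], of _ "\<lambda>p. (n, p)"] continuous_intros)
      (auto simp: C_def cbox_Pair_eq)
  have "integral (cbox (0, t1) (L, t2)) (\<lambda>p. dd eT f (n, p))
      = integral (cbox 0 L) (\<lambda>s. integral (cbox t1 t2) (\<lambda>t. dd eT f (n, s, t)))"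
    by (rule integral_prod_continuous[OF c])
  also have "\<dots> = integral (cbox 0 L) (\<lambda>s. 0)"
  proof (rule integral_cong)
    fix s assume s: "s \<in> cbox 0 L"
    have "((\<lambda>t. dd eT f (n, s, t)) has_integral f (n, s, t2) - f (n, s, t1)) {t1..t2}"
      using t12 s assms(1,2)
      by (intro fundamental_theorem_of_calculus has_vector_derivative_T) (auto simp: C_iff)
    then show "integral (cbox t1 t2) (\<lambda>t. dd eT f (n, s, t)) = 0"
      using assms(3) s by (simp add: integral_unique)
  qed
  finally show ?thesis by simp
qed

end

section \<open>First variation in moving-frame components\<close>

declare transpose_matrix_vector [simp del]

text \<open>An explicit formula, linear on all matrices, so that derivatives pass through it. It
  replaces \<open>axial\<close>, a definite description that is meaningful on skew matrices
  only.\<close>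

definition axial_vec :: "real^3^3 \<Rightarrow> real^3" where
  "axial_vec M = vector [M$3$2, M$1$3, M$2$1]"

lemma bounded_linear_axial_vec: "bounded_linear axial_vec"
  by (simp add: linear_conv_bounded_linear[symmetric] linear_iff axial_vec_def vec_eq_iff forall_3)

lemma axial_eq_axial_vec:
  assumes "transpose M = - M"
  shows "axial M = axial_vec M"
proof -
  have "M $ i $ j = cross3 (axial M) (axis j 1) $ i" for i j
    using axial_skew[OF assms, of "axis j 1"] by (simp add: matrix_vector_mult_basis column_def vec_eq_iff)
  then show ?thesis
    unfolding axial_vec_def by (simp add: cross3_def vec_eq_iff forall_3 axis_def vector_def)
qed

lemma skew_matrix_component:
  fixes M :: "real^'n^'n"
  assumes "transpose M = - M" shows "M $ i $ j = - (M $ j $ i)"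
proof -
  have "transpose M $ j $ i = (- M) $ j $ i" by (simp only: assms)
  then show ?thesis by (simp add: transpose_def)
qed

text \<open>The identification of so(3) with 3-space is an isomorphism of Lie algebras, from the
  commutator to the cross product.\<close>

lemma axial_vec_commutator:
  assumes "transpose A = - A" "transpose B = - B"
  shows "axial_vec (A ** B - B ** A) = cross3 (axial_vec A) (axial_vec B)"
proof -
  have d: "A $ i $ i = 0" "B $ i $ i = 0" for i
    using skew_matrix_component[OF assms(1), of i i] skew_matrix_component[OF assms(2), of i i] by simp_all
  note s = skew_matrix_component[OF assms(1), of 1 2] skew_matrix_component[OF assms(1), of 2 3]
    skew_matrix_component[OF assms(1), of 3 1] skew_matrix_component[OF assms(2), of 1 2]
    skew_matrix_component[OF assms(2), of 2 3] skew_matrix_component[OF assms(2), of 3 1]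
  show ?thesis
    by (simp add: axial_vec_def cross3_def matrix_matrix_mult_def vec_eq_iff forall_3 sum_3 d s)
qed

lemma rotation_matrix_inv:
  fixes Q :: "real^'n^'n"
  assumes "rotation_matrix Q"
  shows "transpose Q ** Q = mat 1" "Q ** transpose Q = mat 1" "matrix_inv Q = transpose Q"
proof -
  show o: "transpose Q ** Q = mat 1" "Q ** transpose Q = mat 1"
    using assms by (auto simp: rotation_matrix_def orthogonal_matrix_def)
  \<comment> \<open>\<open>matrix_inv\<close> chooses some two-sided inverse; the transpose shows
    that one exists.\<close>
  have "matrix_inv Q ** Q = mat 1"
    unfolding matrix_inv_def by (rule someI2[of _ "transpose Q"]) (simp_all add: o)
  then have "matrix_inv Q ** (Q ** transpose Q) = transpose Q"
    by (simp add: matrix_mul_assoc)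
  then show "matrix_inv Q = transpose Q" by (simp add: o)
qed

lemma rotation_matrix_inner:
  fixes Q :: "real^'n^'n"
  assumes "rotation_matrix Q"
  shows "(Q *v x) \<bullet> (Q *v y) = x \<bullet> y"
  using assms orthogonal_transformation_matrix[of "(*v) Q"]
  by (simp add: rotation_matrix_def orthogonal_transformation_def)

lemma matrix_vector_inner_transpose: "(A *v x) \<bullet> y = x \<bullet> (transpose A *v y)"
  for A :: "real^'n^'m"
  by (metis dot_lmul_matrix inner_commute transpose_matrix_vector transpose_transpose)

text \<open>Antisymmetry of the triple product in its outer vectors; it isolates \<open>w eN\<close>
  in the variation of the Lagrangian.\<close>

lemma inner_cross3_swap: "u \<bullet> cross3 v w = - (w \<bullet> cross3 v u)"
  by (simp add: cross3_def inner_vec_def sum_3 algebra_simps)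

text \<open>A whole variation is one pair of maps on the box, with the parameter as first
  coordinate, so that varying is a directional derivative like the other two. The isotropic tensor
  of the linear momentum enters as the scalar \<open>c\<close>.\<close>

locale rod_family = parameter_box +
  fixes Phi :: "real \<times> real \<times> real \<Rightarrow> real^3" and Q :: "real \<times> real \<times> real \<Rightarrow> real^3^3"
    and c :: real and GG HH JJ :: "real^3^3"
  assumes smPhi: "smooth_on C Phi" and smQ: "smooth_on C Q"
    and rot: "\<And>x. x \<in> C \<Longrightarrow> rotation_matrix (Q x)"
    and symG: "\<And>x y. x \<bullet> (GG *v y) = (GG *v x) \<bullet> y"
    and symH: "\<And>x y. x \<bullet> (HH *v y) = (HH *v x) \<bullet> y"
    and symJ: "\<And>x y. x \<bullet> (JJ *v y) = (JJ *v x) \<bullet> y"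
begin

text \<open>In the directions \<open>eS\<close>, \<open>eT\<close>, \<open>eN\<close>, \<open>w\<close> collects the moving-frame components of the curvature,
  the spin and \<open>\<delta>\<theta>\<close>; \<open>flux_t\<close> and \<open>flux_S\<close> are the quantities left over on the boundary by the two
  integrations by parts, \<open>moment\<close> is given in moving-frame components, \<open>force\<close> in the ambient space.\<close>
definition "Om h x = transpose (Q x) ** dd h Q x"
definition "w h x = axial_vec (Om h x)"
definition "V x = dd eT Phi x"
definition "tangent x = transpose (Q x) *v dd eS Phi x"
definition "strain_vec x = tangent x - axis 3 1"
definition "stress_vec x = Q x *v (GG *v strain_vec x)"
definition "Lag x = 1/2 * (c * (V x \<bullet> V x)) + 1/2 * (w eT x \<bullet> (JJ *v w eT x))
   - 1/2 * (strain_vec x \<bullet> (GG *v strain_vec x)) - 1/2 * (w eS x \<bullet> (HH *v w eS x))"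
definition "flux_t x = c * (V x \<bullet> dd eN Phi x) + (JJ *v w eT x) \<bullet> w eN x"
definition "flux_S x = stress_vec x \<bullet> dd eN Phi x + (HH *v w eS x) \<bullet> w eN x"
definition "force x = dd eS stress_vec x - c *\<^sub>R dd eT V x"
definition "moment x = HH *v dd eS (w eS) x + cross3 (w eS x) (HH *v w eS x)
   + cross3 (tangent x) (GG *v strain_vec x) - JJ *v dd eT (w eT) x - cross3 (w eT x) (JJ *v w eT x)"

section \<open>Smoothness of the fields and kinematics of the moving frame\<close>

lemma smooth_Om: "sm (Om h)"
  unfolding Om_def[abs_def] by (intro smooth_intros smooth_dd smQ)

lemma smooth_w: "sm (w h)"
  unfolding w_def[abs_def] by (intro smooth_on_bounded_linear[OF bounded_linear_axial_vec] smooth_Om)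

lemma smooth_V: "sm V"
  unfolding V_def[abs_def] by (intro smooth_dd smPhi)

lemma smooth_tangent: "sm tangent"
  unfolding tangent_def[abs_def] by (intro smooth_intros smooth_dd smPhi smQ)

lemma smooth_strain_vec: "sm strain_vec"
  unfolding strain_vec_def[abs_def] by (intro smooth_intros smooth_tangent)

lemma smooth_stress_vec: "sm stress_vec"
  unfolding stress_vec_def[abs_def] by (intro smooth_intros smooth_strain_vec smQ)

lemmas smooth_fields = smPhi smQ smooth_w smooth_V smooth_tangent smooth_strain_vec smooth_stress_vec

lemma smooth_Lag: "sm Lag"
  unfolding Lag_def[abs_def] by (intro smooth_intros smooth_fields)

lemma smooth_flux_t: "sm flux_t"
  unfolding flux_t_def[abs_def] by (intro smooth_intros smooth_fields smooth_dd)

lemma smooth_flux_S: "sm flux_S"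
  unfolding flux_S_def[abs_def] by (intro smooth_intros smooth_fields smooth_dd)

lemma smooth_force: "sm force"
  unfolding force_def[abs_def] by (intro smooth_intros smooth_fields smooth_dd)

lemma smooth_moment: "sm moment"
  unfolding moment_def[abs_def] by (intro smooth_intros smooth_fields smooth_dd)

text \<open>Differentiate the constraint that \<open>transpose (Q x) ** Q x\<close> is the
  identity.\<close>

lemma skew_Om: assumes x: "x \<in> C" shows "transpose (Om h x) = - Om h x"
proof -
  have "dd h (\<lambda>x. transpose (Q x) ** Q x) x = dd h (\<lambda>x. mat 1) x"
    by (rule dd_cong) (auto intro!: smooth_intros smQ rotation_matrix_inv rot x)
  then have "transpose (Q x) ** dd h Q x + transpose (dd h Q x) ** Q x = 0"
    by (simp add: dd_simps x smQ smooth_intros)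
  then show ?thesis
    unfolding Om_def by (simp add: matrix_transpose_mul transpose_transpose eq_neg_iff_add_eq_0 add.commute)
qed

lemma axial_Om: "x \<in> C \<Longrightarrow> axial (Om h x) = w h x"
  by (simp add: w_def axial_eq_axial_vec skew_Om)

lemma Om_cross: "x \<in> C \<Longrightarrow> Om h x *v y = cross3 (w h x) y"
  unfolding w_def by (metis axial_skew axial_eq_axial_vec skew_Om)

lemma dd_Q: "x \<in> C \<Longrightarrow> dd h Q x = Q x ** Om h x"
  unfolding Om_def by (simp add: matrix_mul_assoc rotation_matrix_inv rot matrix_mul_lid)

lemma dd_Q_vec: "x \<in> C \<Longrightarrow> dd h Q x *v y = Q x *v cross3 (w h x) y"
  by (simp add: dd_Q Om_cross flip: matrix_vector_mul_assoc)

lemma dd_Q_transpose_vec: "x \<in> C \<Longrightarrow> transpose (dd h Q x) *v y = cross3 (transpose (Q x) *v y) (w h x)"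
  by (simp add: dd_Q matrix_transpose_mul skew_Om matrix_vector_mul_assoc[symmetric] Om_cross
      cross_skew[of _ "w h x"] bounded_bilinear.minus_left[OF bounded_bilinear_matrix_vector_mult])

text \<open>The compatibility equation: mixed second derivatives of \<open>Q\<close> commute, so only the commutator of
  the two skew matrices survives.\<close>
lemma dd_w_compatibility:
  assumes x: "x \<in> C" and mixed: "dd h (dd k Q) x = dd k (dd h Q) x"
  shows "dd h (w k) x = dd k (w h) x + cross3 (w k x) (w h x)"
proof -
  have "dd h (Om k) x - dd k (Om h) x = transpose (dd h Q x) ** dd k Q x - transpose (dd k Q x) ** dd h Q x"
    unfolding Om_def[abs_def] by (simp add: dd_simps x smQ smooth_intros smooth_dd mixed)
  also have "\<dots> = Om k x ** Om h x - Om h x ** Om k x"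
  proof -
    \<comment> \<open>Writing both derivatives as \<open>Q x\<close> times \<open>Om\<close>, the
      inner factor \<open>transpose (Q x) ** Q x\<close> drops out and skewness supplies the
      sign.\<close>
    have "transpose (dd h Q x) ** dd k Q x = - (Om h x ** Om k x)" for h k
    proof -
      have "transpose (dd h Q x) ** dd k Q x = transpose (Om h x) ** (transpose (Q x) ** Q x) ** Om k x"
        by (simp add: dd_Q x matrix_transpose_mul matrix_mul_assoc)
      then show ?thesis
        by (simp add: rotation_matrix_inv rot x matrix_mul_rid skew_Om
            bounded_bilinear.minus_left[OF bounded_bilinear_matrix_mult])
    qed
    then show ?thesis by simp
  qed
  finally have *: "dd h (Om k) x - dd k (Om h) x = Om k x ** Om h x - Om h x ** Om k x" .
  have "dd h (w k) x - dd k (w h) x = axial_vec (dd h (Om k) x - dd k (Om h) x)"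
    unfolding w_def[abs_def]
    by (simp add: dd_linear[OF bounded_linear_axial_vec] smooth_Om x linear_diff[OF bounded_linear.linear[OF bounded_linear_axial_vec]])
  then show ?thesis
    unfolding * axial_vec_commutator[OF skew_Om[OF x] skew_Om[OF x]] by (simp add: w_def algebra_simps)
qed

section \<open>Variation of the Lagrangian density\<close>

lemma dd_tangent:
  assumes x: "x \<in> C"
  shows "dd eN tangent x = transpose (Q x) *v dd eN (dd eS Phi) x + cross3 (tangent x) (w eN x)"
  unfolding tangent_def[abs_def]
  by (simp add: dd_simps x smQ smPhi smooth_intros smooth_dd dd_Q_transpose_vec)

lemma dd_strain_vec: "x \<in> C \<Longrightarrow> dd h strain_vec x = dd h tangent x"
  unfolding strain_vec_def[abs_def] by (simp add: dd_simps smooth_tangent smooth_intros)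

text \<open>Symmetry of the tensors makes the two product-rule terms of each quadratic form equal,
  which absorbs the factor 1/2.\<close>

lemma dd_Lag:
  assumes x: "x \<in> C"
  shows "dd eN Lag x = c * (V x \<bullet> dd eN V x) + (JJ *v w eT x) \<bullet> dd eN (w eT) x
    - (GG *v strain_vec x) \<bullet> dd eN tangent x - (HH *v w eS x) \<bullet> dd eN (w eS) x"
proof -
  note sw = symG[of "strain_vec x" "dd eN tangent x"] symH[of "w eS x" "dd eN (w eS) x"] symJ[of "w eT x" "dd eN (w eT) x"]
  show ?thesis
    unfolding Lag_def[abs_def] using sw
    by (simp only: dd_simps x smooth_fields smooth_intros dd_strain_vec) (simp add: inner_commute field_simps)
qed

text \<open>Compatibility turns the varied spin and curvature into derivatives of
  \<open>w eN\<close> plus cross products. The product rule collects the derivatives into the two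
  fluxes; the triple product moves the cross terms into \<open>moment\<close>.\<close>

lemma dd_Lag_divergence:
  assumes x: "x \<in> C"
  shows "dd eN Lag x = dd eT flux_t x - dd eS flux_S x + dd eN Phi x \<bullet> force x + w eN x \<bullet> moment x"
proof -
  have X: "dd eT flux_t x = c * (V x \<bullet> dd eN V x + dd eT V x \<bullet> dd eN Phi x)
      + (JJ *v w eT x) \<bullet> dd eT (w eN) x + (JJ *v dd eT (w eT) x) \<bullet> w eN x"
    unfolding flux_t_def[abs_def]
    by (simp add: dd_simps x smooth_fields smooth_intros smooth_dd dd_commute_T[OF smPhi x])
      (simp add: V_def[abs_def])
  \<comment> \<open>The ambient stress is paired in frame components here, to cancel against the
    matching term of \<open>dd_tangent\<close>.\<close>
  have Y: "dd eS flux_S x = (GG *v strain_vec x) \<bullet> (transpose (Q x) *v dd eN (dd eS Phi) x) + dd eS stress_vec x \<bullet> dd eN Phi x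
      + (HH *v w eS x) \<bullet> dd eS (w eN) x + (HH *v dd eS (w eS) x) \<bullet> w eN x"
    unfolding flux_S_def[abs_def]
    by (simp add: dd_simps x smooth_fields smooth_intros smooth_dd dd_commute_S[OF smPhi x])
      (simp add: stress_vec_def[abs_def] matrix_vector_inner_transpose)
  have wT: "dd eN (w eT) x = dd eT (w eN) x + cross3 (w eT x) (w eN x)"
    by (rule dd_w_compatibility[OF x dd_commute_T[OF smQ x, symmetric]])
  have wS: "dd eN (w eS) x = dd eS (w eN) x + cross3 (w eS x) (w eN x)"
    by (rule dd_w_compatibility[OF x dd_commute_S[OF smQ x, symmetric]])
  show ?thesis
    unfolding dd_Lag[OF x] X Y wT wS dd_tangent[OF x] force_def moment_def
    by (simp add: inner_add_right inner_diff_right inner_add_left algebra_simps inner_commute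
        inner_cross3_swap[of _ _ "w eN x"])
qed

text \<open>Differentiation under the integral sign, followed by the divergence identity; the
  assumed boundary values remove both fluxes.\<close>

lemma first_variation:
  assumes "\<And>s. s \<in> {0..L} \<Longrightarrow> flux_t (0, s, t1) = 0 \<and> flux_t (0, s, t2) = 0"
    and "\<And>t. t \<in> {t1..t2} \<Longrightarrow> flux_S (0, 0, t) = 0 \<and> flux_S (0, L, t) = 0"
  shows "((\<lambda>n. integral (cbox (0, t1) (L, t2)) (\<lambda>p. Lag (n, p))) has_real_derivative
    integral (cbox (0, t1) (L, t2)) (\<lambda>p. dd eN Phi (0, p) \<bullet> force (0, p) + w eN (0, p) \<bullet> moment (0, p))) (at 0)"
proof -
  let ?D = "cbox (0, t1) (L, t2)"
  have D: "p \<in> ?D \<longleftrightarrow> p \<in> {0..L} \<times> {t1..t2}" for p by (simp add: cbox_Pair_eq)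
  have cont: "continuous_on ?D (\<lambda>p. f (n, p))" if "sm f" "n \<in> {-al..al}" for f :: "_ \<Rightarrow> real" and n
    by (rule smooth_continuous_compose[OF that(1), of _ "\<lambda>p. (n, p)"])
      (use that(2) in \<open>auto intro!: continuous_intros simp: C_def D\<close>)
  have z: "(0::real) \<in> {-al..al}" using al by simp
  have "((\<lambda>n. integral ?D (\<lambda>p. Lag (n, p))) has_real_derivative integral ?D (\<lambda>p. dd eN Lag (0, p)))
      (at 0 within {-al..al})"
  proof (rule leibniz_rule_field_derivative[where f = "\<lambda>n p. Lag (n, p)" and fx = "\<lambda>n p. dd eN Lag (n, p)"])
    show "((\<lambda>n. Lag (n, p)) has_real_derivative dd eN Lag (n, p)) (at n within {-al..al})"
      if "n \<in> {-al..al}" "p \<in> ?D" for n p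
      using has_vector_derivative_N[OF smooth_Lag, of n "fst p" "snd p"] that
      by (simp add: has_real_derivative_iff_has_vector_derivative C_def D mem_Times_iff)
    show "continuous_on ({-al..al} \<times> ?D) (\<lambda>(n, p). dd eN Lag (n, p))"
      using smooth_on_continuous_on[OF smooth_dd[OF smooth_Lag], of eN]
      by (simp add: C_def cbox_Pair_eq split_beta)
  qed (use z in \<open>auto intro!: integrable_continuous cont smooth_Lag\<close>)
  moreover have "at (0::real) within {-al..al} = at 0"
    using al by (intro at_within_interior) simp
  moreover have "integral ?D (\<lambda>p. dd eN Lag (0, p))
    = integral ?D (\<lambda>p. dd eN Phi (0, p) \<bullet> force (0, p) + w eN (0, p) \<bullet> moment (0, p))"
  proof -
    have smooth_work: "sm (\<lambda>x. dd eN Phi x \<bullet> force x + w eN x \<bullet> moment x)"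
      by (intro smooth_intros smooth_dd smooth_fields smooth_force smooth_moment)
    have i: "(\<lambda>p. dd eT flux_t (0, p)) integrable_on ?D" "(\<lambda>p. dd eS flux_S (0, p)) integrable_on ?D"
      "(\<lambda>p. dd eN Phi (0, p) \<bullet> force (0, p) + w eN (0, p) \<bullet> moment (0, p)) integrable_on ?D"
      using cont[OF smooth_dd[OF smooth_flux_t] z] cont[OF smooth_dd[OF smooth_flux_S] z]
        cont[OF smooth_work z]
      by (auto intro!: integrable_continuous)
    have "integral ?D (\<lambda>p. dd eN Lag (0, p)) = integral ?D (\<lambda>p. (dd eT flux_t (0, p) - dd eS flux_S (0, p))
      + (dd eN Phi (0, p) \<bullet> force (0, p) + w eN (0, p) \<bullet> moment (0, p)))"
      by (rule integral_cong) (use z in \<open>simp add: dd_Lag_divergence C_def D\<close>)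
    also have "\<dots> = (integral ?D (\<lambda>p. dd eT flux_t (0, p)) - integral ?D (\<lambda>p. dd eS flux_S (0, p)))
      + integral ?D (\<lambda>p. dd eN Phi (0, p) \<bullet> force (0, p) + w eN (0, p) \<bullet> moment (0, p))"
      using i by (subst integral_add) (auto intro: integrable_diff simp: integral_diff)
    finally show ?thesis
      using integral_dd_T_eq_0[OF smooth_flux_t z assms(1)] integral_dd_S_eq_0[OF smooth_flux_S z assms(2)] by simp
  qed
  ultimately show ?thesis by simp
qed

section \<open>Dictionary between a configuration and the fields on one slice of the box\<close>

context
  fixes phi :: "real \<times> real \<Rightarrow> real^3" and R :: "real \<times> real \<Rightarrow> real^3^3" and n :: real
  assumes phi: "\<And>p. p \<in> {0..L} \<times> {t1..t2} \<Longrightarrow> phi p = Phi (n, p)"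
    and R: "\<And>p. p \<in> {0..L} \<times> {t1..t2} \<Longrightarrow> R p = Q (n, p)"
    and n: "n \<in> {-al..al}"
begin

lemma in_C: "p \<in> {0..L} \<times> {t1..t2} \<Longrightarrow> (n, p) \<in> C"
  using n by (simp add: C_def)

lemma matrix_inv_slice: "p \<in> {0..L} \<times> {t1..t2} \<Longrightarrow> matrix_inv (Q (n, p)) = transpose (Q (n, p))"
  by (rule rotation_matrix_inv(3)[OF rot[OF in_C]])

lemma tensor_slice:
  "p \<in> {0..L} \<times> {t1..t2} \<Longrightarrow> tensor X (R p) (Q (n, p) *v u) = Q (n, p) *v (X *v u)"
  using rotation_matrix_inv(1)[OF rot[OF in_C], of p]
  by (simp add: tensor_def spatial_def matrix_inv_slice R matrix_vector_mul_assoc[of "transpose (Q (n, p))"])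

context
  fixes p assumes p: "p \<in> {0..L} \<times> {t1..t2}"
begin

lemma velocity_slice: "velocity t1 t2 phi p = V (n, p)"
  using partial_t_slice[OF smPhi phi n p] by (simp add: velocity_def V_def)

lemma linear_momentum_slice: "linear_momentum t1 t2 (mat c) phi R p = c *\<^sub>R V (n, p)"
proof -
  \<comment> \<open>The velocity is rewritten through its frame components so that
    \<open>tensor_slice\<close> applies; the scalar matrix then commutes with the rotation.\<close>
  have "V (n, p) = Q (n, p) *v (transpose (Q (n, p)) *v V (n, p))"
    using rotation_matrix_inv(2)[OF rot[OF in_C[OF p]]] by (simp add: matrix_vector_mul_assoc)
  then have "linear_momentum t1 t2 (mat c) phi R p = Q (n, p) *v (mat c *v (transpose (Q (n, p)) *v V (n, p)))"
    using tensor_slice[OF p] unfolding linear_momentum_def velocity_slice by metis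
  also have "mat c *v u = c *\<^sub>R u" for u :: "real^3"
    by (simp add: vec_eq_iff forall_3 matrix_vector_mult_def sum_3 mat_def)
  finally show ?thesis
    using rotation_matrix_inv(2)[OF rot[OF in_C[OF p]]]
    by (simp add: matrix_vector_mult_scaleR matrix_vector_mul_assoc)
qed

lemma spin_slice: "spin t1 t2 R p = Q (n, p) *v w eT (n, p)"
  using partial_t_slice[OF smQ R n p] p
  by (simp add: spin_def spatial_def matrix_inv_slice R in_C flip: Om_def axial_Om)

lemma angular_momentum_slice: "angular_momentum t1 t2 JJ R p = Q (n, p) *v (JJ *v w eT (n, p))"
  by (simp add: angular_momentum_def spin_slice tensor_slice[OF p])

lemma strain_slice: "strain L phi R p = Q (n, p) *v strain_vec (n, p)"
  using partial_S_slice[OF smPhi phi n p] rotation_matrix_inv(2)[OF rot[OF in_C[OF p]]] R[OF p]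
  by (simp add: strain_def strain_vec_def tangent_def matrix_vector_mult_diff_distrib matrix_vector_mul_assoc)

lemma stress_slice: "stress L GG phi R p = stress_vec (n, p)"
  by (simp add: stress_def strain_slice tensor_slice[OF p] stress_vec_def)

lemma curvature_slice: "curvature L R p = Q (n, p) *v w eS (n, p)"
  using partial_S_slice[OF smQ R n p] p
  by (simp add: curvature_def spatial_def matrix_inv_slice R in_C flip: Om_def axial_Om)

lemma couple_slice: "couple L HH R p = Q (n, p) *v (HH *v w eS (n, p))"
  by (simp add: couple_def curvature_slice tensor_slice[OF p])

text \<open>Rotations preserve inner products, so the energies may be computed from frame
  components.\<close>

lemma Lag_slice:
  "1/2 * (velocity t1 t2 phi p \<bullet> linear_momentum t1 t2 (mat c) phi R p)
       + 1/2 * (spin t1 t2 R p \<bullet> angular_momentum t1 t2 JJ R p)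
       - 1/2 * (strain L phi R p \<bullet> stress L GG phi R p)
       - 1/2 * (curvature L R p \<bullet> couple L HH R p) = Lag (n, p)"
  unfolding velocity_slice linear_momentum_slice spin_slice angular_momentum_slice strain_slice
    stress_slice curvature_slice couple_slice
  by (simp add: stress_vec_def rotation_matrix_inner[OF rot[OF in_C[OF p]]] Lag_def)

end

lemma action_slice:
  "action L t1 t2 GG HH (mat c) JJ phi R = integral (cbox (0, t1) (L, t2)) (\<lambda>p. Lag (n, p))"
proof -
  have cont: "continuous_on (cbox (0, t1) (L, t2)) (\<lambda>p. Lag (n, p))"
    by (rule smooth_continuous_compose[OF smooth_Lag, of _ "\<lambda>p. (n, p)"])
      (use n in \<open>auto intro!: continuous_intros simp: C_def cbox_Pair_eq\<close>)
  have "action L t1 t2 GG HH (mat c) JJ phi R = integral {t1..t2} (\<lambda>t. integral {0..L} (\<lambda>s. Lag (n, s, t)))"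
    unfolding action_def by (intro integral_cong Lag_slice) auto
  \<comment> \<open>The action integrates over \<open>S\<close> first, the product integral over
    \<open>t\<close> first.\<close>
  also have "\<dots> = integral (cbox 0 L) (\<lambda>s. integral (cbox t1 t2) (\<lambda>t. Lag (n, s, t)))"
    using integral_swap_continuous[of 0 t1 L t2 "\<lambda>s t. Lag (n, s, t)"] cont by (simp add: split_beta)
  also have "\<dots> = integral (cbox (0, t1) (L, t2)) (\<lambda>p. Lag (n, p))"
    by (rule integral_prod_continuous[OF cont, symmetric])
  finally show ?thesis .
qed

lemma force_slice:
  assumes p: "p \<in> {0..L} \<times> {t1..t2}"
  shows "partial_S L (stress L GG phi R) p - partial_t t1 t2 (linear_momentum t1 t2 (mat c) phi R) p
    = force (n, p)"
proof -
  have cV: "sm (\<lambda>x. c *\<^sub>R V x)" by (intro smooth_intros smooth_V)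
  show ?thesis
    using partial_S_slice[OF smooth_stress_vec stress_slice n p]
      partial_t_slice[OF cV linear_momentum_slice n p] in_C[OF p]
    by (simp add: force_def dd_simps smooth_V smooth_intros)
qed

text \<open>Differentiating the rotating frame produces the terms \<open>cross3 (w h x)\<close> of
  \<open>moment\<close>. Rotations commute with the cross product, so the whole balance is the
  rotated \<open>moment\<close>.\<close>

lemma moment_slice:
  assumes p: "p \<in> {0..L} \<times> {t1..t2}"
  shows "partial_S L (couple L HH R) p + cross3 (partial_S L phi p) (stress L GG phi R p)
    - partial_t t1 t2 (angular_momentum t1 t2 JJ R) p = Q (n, p) *v moment (n, p)"
proof -
  have sm: "sm (\<lambda>x. Q x *v (HH *v w eS x))" "sm (\<lambda>x. Q x *v (JJ *v w eT x))"
    by (intro smooth_intros smooth_fields)+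
  have d: "dd h (\<lambda>x. Q x *v (B *v w k x)) (n, p)
     = Q (n, p) *v (B *v dd h (w k) (n, p) + cross3 (w h (n, p)) (B *v w k (n, p)))" for h k B
    using in_C[OF p]
    by (simp add: dd_simps smooth_intros smooth_fields dd_Q_vec matrix_vector_right_distrib)
  have tangent: "dd eS Phi (n, p) = Q (n, p) *v tangent (n, p)"
    using rotation_matrix_inv(2)[OF rot[OF in_C[OF p]]] by (simp add: tangent_def matrix_vector_mul_assoc)
  show ?thesis
    unfolding partial_S_slice[OF sm(1) couple_slice n p, simplified] partial_S_slice[OF smPhi phi n p, simplified]
      partial_t_slice[OF sm(2) angular_momentum_slice n p, simplified] d stress_slice[OF p] tangent stress_vec_def
      cross_rotation_matrix[OF rot[OF in_C[OF p]]] moment_def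
    by (simp add: algebra_simps matrix_vector_right_distrib matrix_vector_mult_diff_distrib)
qed

end

end

section \<open>Hamilton's principle\<close>

text \<open>Stated for a single configuration, so that the same residual is tested by every
  variation of it.\<close>

definition force_defect where
  "force_defect L t1 t2 GG AA phi R p =
     partial_S L (stress L GG phi R) p - partial_t t1 t2 (linear_momentum t1 t2 AA phi R) p"

definition moment_defect where
  "moment_defect L t1 t2 GG HH JJ phi R p =
     partial_S L (couple L HH R) p + cross3 (partial_S L phi p) (stress L GG phi R p)
       - partial_t t1 t2 (angular_momentum t1 t2 JJ R) p"

lemma delta_theta_slice:
  assumes "rod_family al L t1 t2 Phi Q GG HH JJ"
    and "\<And>n p. p \<in> {0..L} \<times> {t1..t2} \<Longrightarrow> q n p = Q (n, p)"
    and "\<And>p. p \<in> {0..L} \<times> {t1..t2} \<Longrightarrow> R p = Q (0, p)"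
    and p: "p \<in> {0..L} \<times> {t1..t2}"
  shows "delta_theta R q p = Q (0, p) *v rod_family.w al L t1 t2 Q (1, 0, 0) (0, p)"
proof -
  interpret rod_family al L t1 t2 Phi Q c GG HH JJ for c by fact
  have x: "(0, p) \<in> C" using p al by (simp add: C_def)
  have "delta q p = dd eN Q (0, p)" by (rule delta_slice[OF smQ]) (use assms p in auto)
  then show ?thesis
    using x by (simp add: delta_theta_def spatial_def assms(3)[OF p] rotation_matrix_inv(3)[OF rot[OF x]]
        axial_eq_axial_vec[OF skew_Om[OF x]] w_def flip: Om_def)
qed

text \<open>The first variation formula in ambient terms; both directions of the equivalence rest on
  it.\<close>

lemma action_has_derivative:
  fixes GG HH JJ :: "real^3^3"
  assumes "0 < L" "t1 < t2"
    and sym: "\<And>x y. x \<bullet> (GG *v y) = (GG *v x) \<bullet> y" "\<And>x y. x \<bullet> (HH *v y) = (HH *v x) \<bullet> y"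
      "\<And>x y. x \<bullet> (JJ *v y) = (JJ *v x) \<bullet> y"
    and fam: "smooth_family L t1 t2 a phi R Phi Q"
    and adm: "admissible_variation L t1 t2 GG HH phi R Phi Q"
  shows "((\<lambda>nu. action L t1 t2 GG HH (mat c) JJ (Phi nu) (Q nu)) has_real_derivative
    integral (cbox (0, t1) (L, t2)) (\<lambda>p. delta Phi p \<bullet> force_defect L t1 t2 GG (mat c) phi R p
      + delta_theta R Q p \<bullet> moment_defect L t1 t2 GG HH JJ phi R p)) (at 0)"
proof -
  let ?D = "{0..L} \<times> {t1..t2}"
  have a: "0 < a" using fam by (simp add: smooth_family_def)
  \<comment> \<open>The family lives on an open parameter interval; halving \<open>a\<close> gives a
    closed box inside it.\<close>
  interpret parameter_box "a / 2" L t1 t2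
    using a assms(1,2) by unfold_locales auto
  have sub: "C \<subseteq> {-a<..<a} \<times> ?D" using a by (auto simp: C_def)
  interpret rod_family "a / 2" L t1 t2 "\<lambda>(n, p). Phi n p" "\<lambda>(n, p). Q n p" c GG HH JJ
  proof
    show "sm (\<lambda>(n, p). Phi n p)" "sm (\<lambda>(n, p). Q n p)"
      using fam sub by (auto simp: smooth_family_def intro: smooth_on_subset)
    show "rotation_matrix (case x of (n, p) \<Rightarrow> Q n p)" if "x \<in> C" for x
      using fam sub that by (auto simp: smooth_family_def)
  qed (simp_all add: sym)
  have z: "(0::real) \<in> {-(a/2)..a/2}" using a by simp
  have phi: "phi p = (\<lambda>(n, p). Phi n p) (0, p)" and R: "R p = (\<lambda>(n, p). Q n p) (0, p)" if "p \<in> ?D" for p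
    using fam that by (auto simp: smooth_family_def)
  have R0: "rotation_matrix (Q 0 p)" if "p \<in> ?D" for p
    using rot[of "(0, p)"] that z by (simp add: C_def)
  have dPhi: "delta Phi p = dd eN (\<lambda>(n, p). Phi n p) (0, p)" if "p \<in> ?D" for p
    by (rule delta_slice[OF smPhi]) (use that in auto)
  have dQ: "delta_theta R Q p = Q 0 p *v w eN (0, p)" if "p \<in> ?D" for p
    using delta_theta_slice[OF rod_family_axioms _ R that, of Q] by simp
  note stress = stress_slice[OF phi R z] and couple = couple_slice[OF phi R z]
  have der: "((\<lambda>n. integral (cbox (0, t1) (L, t2)) (\<lambda>p. Lag (n, p))) has_real_derivative
    integral (cbox (0, t1) (L, t2)) (\<lambda>p. dd eN (\<lambda>(n, p). Phi n p) (0, p) \<bullet> force (0, p) + w eN (0, p) \<bullet> moment (0, p))) (at 0)"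
  proof (rule first_variation)
    fix s assume s: "s \<in> {0..L}"
    have "flux_t (0, s, t) = 0" if t: "t \<in> {t1, t2}" for t
    proof -
      have p: "(s, t) \<in> ?D" using s t t12 by auto
      have "delta Phi (s, t) = 0" "delta_theta R Q (s, t) = 0"
        using adm s t unfolding admissible_variation_def by blast+
      \<comment> \<open>A rotation preserves length, so \<open>w eN\<close> vanishes together with
        \<open>delta_theta\<close>.\<close>
      then have "w eN (0, s, t) \<bullet> w eN (0, s, t) = 0" "dd eN (\<lambda>(n, p). Phi n p) (0, s, t) = 0"
        using dQ[OF p] dPhi[OF p] rotation_matrix_inner[OF R0[OF p], of "w eN (0, s, t)" "w eN (0, s, t)"] by simp_all
      then show ?thesis by (simp add: flux_t_def)
    qed
    then show "flux_t (0, s, t1) = 0 \<and> flux_t (0, s, t2) = 0" by simp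
  next
    fix t assume t: "t \<in> {t1..t2}"
    have "flux_S (0, s, t) = 0" if s: "s \<in> {0, L}" for s
    proof -
      have p: "(s, t) \<in> ?D" using s t L by auto
      have "delta Phi (s, t) \<bullet> stress L GG phi R (s, t) = 0" "delta_theta R Q (s, t) \<bullet> couple L HH R (s, t) = 0"
        using adm s t unfolding admissible_variation_def by blast+
      \<comment> \<open>The two summands of \<open>flux_S\<close> are exactly the two boundary
        products assumed to vanish, the second after undoing the rotation.\<close>
      then show ?thesis
        using stress[OF _ _ p] couple[OF _ _ p] dQ[OF p] dPhi[OF p] rotation_matrix_inner[OF R0[OF p]]
        by (simp add: flux_S_def inner_commute)
    qed
    then show "flux_S (0, 0, t) = 0 \<and> flux_S (0, L, t) = 0" by simp
  qed
  have "((\<lambda>nu. action L t1 t2 GG HH (mat c) JJ (Phi nu) (Q nu)) has_real_derivative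
    integral (cbox (0, t1) (L, t2)) (\<lambda>p. dd eN (\<lambda>(n, p). Phi n p) (0, p) \<bullet> force (0, p) + w eN (0, p) \<bullet> moment (0, p))) (at 0)"
    \<comment> \<open>The action agrees with the slice integral for parameters near 0, which
      suffices for the derivative there.\<close>
    by (rule has_field_derivative_transform_within_open[OF der, of "{-(a/2)<..<a/2}"])
      (use a in \<open>auto intro!: action_slice[symmetric]\<close>)
  moreover have "integral (cbox (0, t1) (L, t2)) (\<lambda>p. dd eN (\<lambda>(n, p). Phi n p) (0, p) \<bullet> force (0, p) + w eN (0, p) \<bullet> moment (0, p))
     = integral (cbox (0, t1) (L, t2)) (\<lambda>p. delta Phi p \<bullet> force_defect L t1 t2 GG (mat c) phi R p
      + delta_theta R Q p \<bullet> moment_defect L t1 t2 GG HH JJ phi R p)"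
  proof (rule integral_cong)
    fix p assume "p \<in> cbox (0, t1) (L, t2)"
    then have p: "p \<in> ?D" by (simp add: cbox_Pair_eq)
    show "dd eN (\<lambda>(n, p). Phi n p) (0, p) \<bullet> force (0, p) + w eN (0, p) \<bullet> moment (0, p)
      = delta Phi p \<bullet> force_defect L t1 t2 GG (mat c) phi R p
      + delta_theta R Q p \<bullet> moment_defect L t1 t2 GG HH JJ phi R p"
      using force_slice[OF phi R z p] moment_slice[OF phi R z p]
      unfolding force_defect_def moment_defect_def dPhi[OF p] dQ[OF p]
      by (simp add: rotation_matrix_inner[OF R0[OF p]])
  qed
  ultimately show ?thesis by simp
qed

text \<open>The configuration is extended to a family constant in the parameter; its smooth
  \<open>force\<close> and rotated \<open>moment\<close> restrict to the defects on the slice at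
  0.\<close>

lemma smooth_defects:
  fixes GG HH JJ :: "real^3^3"
  assumes "0 < L" "t1 < t2"
    and sym: "\<And>x y. x \<bullet> (GG *v y) = (GG *v x) \<bullet> y" "\<And>x y. x \<bullet> (HH *v y) = (HH *v x) \<bullet> y"
      "\<And>x y. x \<bullet> (JJ *v y) = (JJ *v x) \<bullet> y"
    and phi: "smooth_on ({0..L} \<times> {t1..t2}) phi" and R: "smooth_on ({0..L} \<times> {t1..t2}) R"
    and rotR: "\<And>p. p \<in> {0..L} \<times> {t1..t2} \<Longrightarrow> rotation_matrix (R p)"
  shows "smooth_on ({0..L} \<times> {t1..t2}) (force_defect L t1 t2 GG (mat c) phi R)"
    and "smooth_on ({0..L} \<times> {t1..t2}) (moment_defect L t1 t2 GG HH JJ phi R)"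
proof -
  let ?D = "{0..L} \<times> {t1..t2}"
  interpret parameter_box 1 L t1 t2 using assms(1,2) by unfold_locales auto
  interpret rod_family 1 L t1 t2 "\<lambda>x. phi (snd x)" "\<lambda>x. R (snd x)" c GG HH JJ
    by unfold_locales
      (auto simp: sym C_def intro!: rotR smooth_on_compose_linear[OF bounded_linear_snd _ phi]
        smooth_on_compose_linear[OF bounded_linear_snd _ R])
  have z: "(0::real) \<in> {-1..1}" by simp
  have slice: "smooth_on ?D (\<lambda>p. f (0, p))" if "sm f" for f :: "_ \<Rightarrow> real^3"
    by (rule smooth_on_compose_linear[OF _ _ that, of "\<lambda>p. (0, p)"])
      (auto simp: C_def intro!: bounded_linear_Pair bounded_linear_zero bounded_linear_ident)
  show "smooth_on ?D (force_defect L t1 t2 GG (mat c) phi R)"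
    by (rule smooth_on_cong[OF _ slice[OF smooth_force]])
      (simp add: force_defect_def force_slice[OF _ _ z])
  have "sm (\<lambda>x. R (snd x) *v moment x)"
    by (intro smooth_intros smQ smooth_moment)
  from slice[OF this] show "smooth_on ?D (moment_defect L t1 t2 GG HH JJ phi R)"
    by (rule smooth_on_cong[rotated]) (simp add: moment_defect_def moment_slice[OF _ _ z])
qed

section \<open>Rotations about a coordinate axis, and a weight for test variations\<close>

definition cross_matrix :: "real^3 \<Rightarrow> real^3^3" where
  "cross_matrix e = vector [vector [0, - e$3, e$2], vector [e$3, 0, - e$1], vector [- e$2, e$1, 0]]"

text \<open>Rodrigues' formula.\<close>
definition axis_rotation :: "real^3 \<Rightarrow> real \<Rightarrow> real^3^3" where
  "axis_rotation e r = mat 1 + sin r *\<^sub>R cross_matrix e + (1 - cos r) *\<^sub>R (cross_matrix e ** cross_matrix e)"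

lemma rotation_matrix_axis_rotation: "rotation_matrix (axis_rotation (axis k 1) r)"
proof -
  have sc: "sin r * sin r = 1 - cos r * cos r"
    using sin_cos_squared_add[of r] by (simp add: power2_eq_square)
  show ?thesis
    unfolding rotation_matrix_def orthogonal_matrix
    using exhaust_3[of k]
    by (auto simp: axis_rotation_def cross_matrix_def axis_def det_3 matrix_matrix_mult_def transpose_def
        mat_def vec_eq_iff forall_3 sum_3 algebra_simps sc)
qed

lemma transpose_cross_matrix: "transpose (cross_matrix e) = - cross_matrix e"
  by (simp add: cross_matrix_def transpose_def vec_eq_iff forall_3)

lemma axial_vec_cross_matrix: "axial_vec (cross_matrix e) = e"
  by (simp add: cross_matrix_def axial_vec_def vec_eq_iff forall_3)

lemma axis_rotation_0: "axis_rotation e 0 = mat 1"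
  by (simp add: axis_rotation_def)

text \<open>The term quadratic in \<open>cross_matrix e\<close> contributes nothing, since 1 - cos
  has derivative 0 at 0.\<close>

lemma has_vector_derivative_axis_rotation:
  "((\<lambda>n. axis_rotation e (n * k)) has_vector_derivative k *\<^sub>R cross_matrix e) (at 0)"
  unfolding axis_rotation_def by (auto intro!: derivative_eq_intros)

definition bump :: "real \<Rightarrow> real \<Rightarrow> real \<Rightarrow> real \<times> real \<Rightarrow> real" where
  "bump L t1 t2 p = (fst p * (L - fst p)) * ((snd p - t1) * (t2 - snd p))"

lemma smooth_bump: "smooth_on D (bump L t1 t2)"
  unfolding bump_def[abs_def]
  by (intro smooth_intros smooth_on_linear[OF bounded_linear_fst] smooth_on_linear[OF bounded_linear_snd])

lemma bump_boundary: "s \<in> {0, L} \<or> t \<in> {t1, t2} \<Longrightarrow> bump L t1 t2 (s, t) = 0"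
  by (auto simp: bump_def)

text \<open>A continuous nonnegative integrand with zero integral vanishes. The weight is positive
  inside, so \<open>g\<close> is zero there, and by continuity on the closed rectangle.\<close>

lemma vanishes_if_bump_integral_0:
  fixes g :: "real \<times> real \<Rightarrow> 'b::real_inner"
  assumes "0 < L" "t1 < t2" and g: "continuous_on ({0..L} \<times> {t1..t2}) g"
    and int: "integral (cbox (0, t1) (L, t2)) (\<lambda>p. bump L t1 t2 p * (g p \<bullet> g p)) = 0"
    and p: "p \<in> {0..L} \<times> {t1..t2}"
  shows "g p = 0"
proof -
  have D: "cbox (0, t1) (L, t2) = {0..L} \<times> {t1..t2}" by (simp add: cbox_Pair_eq)
  have B: "box (0, t1) (L, t2) = {0<..<L} \<times> {t1<..<t2}" by (auto simp: box_def Basis_prod_def)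
  have ne: "box (0, t1) (L, t2) \<noteq> {}" using assms(1,2) by (simp add: B)
  have *: "\<forall>p\<in>cbox (0, t1) (L, t2). bump L t1 t2 p * (g p \<bullet> g p) = 0"
  proof (subst integral_cbox_eq_0_iff[symmetric, OF _ ne])
    show "continuous_on (cbox (0, t1) (L, t2)) (\<lambda>p. bump L t1 t2 p * (g p \<bullet> g p))"
      unfolding D by (intro continuous_intros g smooth_on_continuous_on[OF smooth_bump])
    show "0 \<le> bump L t1 t2 p * (g p \<bullet> g p)" if "p \<in> cbox (0, t1) (L, t2)" for p
      using that by (auto simp: D bump_def)
  qed (rule int)
  have "g q = 0" if "q \<in> box (0, t1) (L, t2)" for q
  proof -
    have "q \<in> cbox (0, t1) (L, t2)" using that box_subset_cbox by blast
    with * have "bump L t1 t2 q * (g q \<bullet> g q) = 0" by blast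
    moreover have "bump L t1 t2 q \<noteq> 0" using that by (auto simp: B bump_def)
    ultimately show ?thesis by simp
  qed
  then show ?thesis
    using continuous_constant_on_closure[of "box (0, t1) (L, t2)" g 0 p] closure_box[OF ne] g p D by simp
qed

section \<open>Necessity and sufficiency of the equations of motion\<close>

lemma inner_diag3: "x \<bullet> (diag3 a b c *v y) = (diag3 a b c *v x) \<bullet> y"
  by (simp add: diag3_def inner_vec_def matrix_vector_mult_def sum_3)

lemma smooth_on_snd: "smooth_on D f \<Longrightarrow> smooth_on (U \<times> D) (\<lambda>x. f (snd x))"
  by (rule smooth_on_compose_linear[OF bounded_linear_snd]) auto

lemma hamilton_imp_force_defect_0:
  fixes GG HH JJ :: "real^3^3"
  assumes "0 < L" "t1 < t2"
    and sym: "\<And>x y. x \<bullet> (GG *v y) = (GG *v x) \<bullet> y" "\<And>x y. x \<bullet> (HH *v y) = (HH *v x) \<bullet> y"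
      "\<And>x y. x \<bullet> (JJ *v y) = (JJ *v x) \<bullet> y"
    and phi: "smooth_on ({0..L} \<times> {t1..t2}) phi" and R: "smooth_on ({0..L} \<times> {t1..t2}) R"
    and rotR: "\<And>p. p \<in> {0..L} \<times> {t1..t2} \<Longrightarrow> rotation_matrix (R p)"
    and ham: "hamilton_principle L t1 t2 GG HH (mat c) JJ phi R"
    and p: "p \<in> {0..L} \<times> {t1..t2}"
  shows "force_defect L t1 t2 GG (mat c) phi R p = 0"
proof -
  let ?D = "{0..L} \<times> {t1..t2}"
  let ?b = "bump L t1 t2"
  let ?F = "force_defect L t1 t2 GG (mat c) phi R"
  let ?Phi = "\<lambda>nu p. phi p + (nu * ?b p) *\<^sub>R ?F p"
  let ?Q = "\<lambda>nu::real. R"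
  have F: "smooth_on ?D ?F" by (rule smooth_defects) (use assms in auto)
  have fam: "smooth_family L t1 t2 1 phi R ?Phi ?Q"
    unfolding smooth_family_def split_beta
    by (auto intro!: rotR smooth_on_snd phi R F smooth_bump smooth_intros smooth_on_linear[OF bounded_linear_fst])
  have dPhi: "delta ?Phi p = ?b p *\<^sub>R ?F p" for p
    unfolding delta_def by (rule vector_derivative_at) (auto intro!: derivative_eq_intros)
  have "axial (0 :: real^3^3) = 0"
    by (simp add: axial_eq_axial_vec linear_0[OF bounded_linear.linear[OF bounded_linear_axial_vec]] transpose_def vec_eq_iff)
  then have dQ: "delta_theta R ?Q p = 0" for p
    by (simp add: delta_theta_def delta_def spatial_def)
  \<comment> \<open>The weight is zero on all four sides, so the time and the end conditions hold at
    once.\<close>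
  have adm: "admissible_variation L t1 t2 GG HH phi R ?Phi ?Q"
    by (auto simp: admissible_variation_def dPhi dQ bump_boundary)
  \<comment> \<open>Uniqueness of the derivative: Hamilton's principle gives 0, the first variation
    formula gives this integral.\<close>
  have "integral (cbox (0, t1) (L, t2)) (\<lambda>p. ?b p * (?F p \<bullet> ?F p)) = 0"
    using DERIV_unique[OF action_has_derivative[OF assms(1,2) sym fam adm]
        ham[unfolded hamilton_principle_def, rule_format, OF fam adm]]
    by (simp add: dPhi dQ)
  then show ?thesis
    using vanishes_if_bump_integral_0 assms(1,2) smooth_on_continuous_on[OF F] p by blast
qed

text \<open>Testing one frame axis at a time keeps the axis constant and lets only the angle vary
  with the point, so explicit trigonometric matrices suffice.\<close>

lemma hamilton_imp_moment_defect_0: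
  fixes GG HH JJ :: "real^3^3"
  assumes "0 < L" "t1 < t2"
    and sym: "\<And>x y. x \<bullet> (GG *v y) = (GG *v x) \<bullet> y" "\<And>x y. x \<bullet> (HH *v y) = (HH *v x) \<bullet> y"
      "\<And>x y. x \<bullet> (JJ *v y) = (JJ *v x) \<bullet> y"
    and phi: "smooth_on ({0..L} \<times> {t1..t2}) phi" and R: "smooth_on ({0..L} \<times> {t1..t2}) R"
    and rotR: "\<And>p. p \<in> {0..L} \<times> {t1..t2} \<Longrightarrow> rotation_matrix (R p)"
    and ham: "hamilton_principle L t1 t2 GG HH (mat c) JJ phi R"
    and p: "p \<in> {0..L} \<times> {t1..t2}"
  shows "moment_defect L t1 t2 GG HH JJ phi R p = 0"
proof -
  let ?D = "{0..L} \<times> {t1..t2}"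
  let ?b = "bump L t1 t2"
  let ?M = "moment_defect L t1 t2 GG HH JJ phi R"
  have M: "smooth_on ?D ?M" by (rule smooth_defects) (use assms in auto)
  have "(transpose (R p) *v ?M p) $ k = 0" for k
  proof -
    let ?e = "axis k 1 :: real^3"
    let ?m = "\<lambda>p. (transpose (R p) *v ?M p) $ k"
    let ?Phi = "\<lambda>nu::real. phi"
    \<comment> \<open>Multiplying on the right rotates about the moving vector
      \<open>R p *v ?e\<close> and stays in the rotation group.\<close>
    let ?Q = "\<lambda>nu p. R p ** axis_rotation ?e (nu * (?b p * ?m p))"
    have m: "smooth_on ?D ?m" by (intro smooth_intros R M)
    have fam: "smooth_family L t1 t2 1 phi R ?Phi ?Q"
      unfolding smooth_family_def split_beta
    proof (intro conjI ballI)
      show "smooth_on ({-1<..<1} \<times> ?D) (\<lambda>x. R (snd x) ** axis_rotation ?e (fst x * (?b (snd x) * ?m (snd x))))"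
        unfolding axis_rotation_def
        by (intro smooth_intros smooth_on_snd smooth_on_linear[OF bounded_linear_fst] R M smooth_bump)
      show "rotation_matrix (?Q nu p)" if "p \<in> ?D" for nu p
        using rotR[OF that] rotation_matrix_axis_rotation[of k "nu * (?b p * ?m p)"]
        by (simp add: rotation_matrix_def orthogonal_matrix_mul det_mul)
    qed (auto intro: smooth_on_snd phi simp: axis_rotation_0 matrix_mul_rid)
    have dPhi: "delta ?Phi p = 0" for p
      by (simp add: delta_def)
    have dQ: "delta_theta R ?Q p = R p *v ((?b p * ?m p) *\<^sub>R ?e)" if p: "p \<in> ?D" for p
    proof -
      have "delta ?Q p = R p ** ((?b p * ?m p) *\<^sub>R cross_matrix ?e)"
        unfolding delta_def
        by (rule vector_derivative_at[OF bounded_linear.has_vector_derivative[OF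
            bounded_bilinear.bounded_linear_right[OF bounded_bilinear_matrix_mult] has_vector_derivative_axis_rotation]])
      then have "matrix_inv (R p) ** delta ?Q p = (?b p * ?m p) *\<^sub>R cross_matrix ?e"
        by (simp add: rotation_matrix_inv[OF rotR[OF p]] matrix_mul_assoc matrix_mul_lid)
      moreover have "axial (r *\<^sub>R cross_matrix ?e) = r *\<^sub>R ?e" for r
        using linear_scale[OF bounded_linear.linear[OF bounded_linear_axial_vec]]
          linear_scale[OF bounded_linear.linear[OF bounded_linear_transpose], of r "cross_matrix ?e"]
        by (simp add: axial_eq_axial_vec transpose_cross_matrix axial_vec_cross_matrix)
      ultimately show ?thesis by (simp add: delta_theta_def spatial_def)
    qed
    have adm: "admissible_variation L t1 t2 GG HH phi R ?Phi ?Q"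
      using assms(1,2) by (auto simp: admissible_variation_def dPhi dQ bump_boundary)
    have "integral (cbox (0, t1) (L, t2)) (\<lambda>p. delta_theta R ?Q p \<bullet> ?M p) = 0"
      using DERIV_unique[OF action_has_derivative[OF assms(1,2) sym fam adm]
          ham[unfolded hamilton_principle_def, rule_format, OF fam adm]]
      by (simp add: dPhi)
    also have "integral (cbox (0, t1) (L, t2)) (\<lambda>p. delta_theta R ?Q p \<bullet> ?M p)
        = integral (cbox (0, t1) (L, t2)) (\<lambda>p. ?b p * (?m p \<bullet> ?m p))"
    proof (rule integral_cong)
      fix p assume "p \<in> cbox (0, t1) (L, t2)"
      then have p: "p \<in> ?D" by (simp add: cbox_Pair_eq)
      show "delta_theta R ?Q p \<bullet> ?M p = ?b p * (?m p \<bullet> ?m p)"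
        unfolding dQ[OF p] matrix_vector_inner_transpose by (simp add: inner_axis' )
    qed
    finally show ?thesis
      using vanishes_if_bump_integral_0[OF assms(1,2) smooth_on_continuous_on[OF m] _ p] by blast
  qed
  \<comment> \<open>All frame components vanish, and rotating back gives the ambient vector.\<close>
  then have "transpose (R p) *v ?M p = 0" by (simp add: vec_eq_iff)
  then have "(R p ** transpose (R p)) *v ?M p = 0" by (simp flip: matrix_vector_mul_assoc)
  then show ?thesis by (simp add: rotation_matrix_inv[OF rotR[OF p]])
qed

theorem corollary3:
  fixes L t1 t2 E G A rho I1 I2 I3 :: real
    and phi :: "real \<times> real \<Rightarrow> real^3"
    and R :: "real \<times> real \<Rightarrow> real^3^3"
    and GG HH AA JJ :: "real^3^3"
  assumes "0 < L" and "t1 < t2"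
    and "0 < G * A" "0 < E * A"
    and "0 < E * I1" "0 < E * I2" "0 < G * I3"
    and "0 < rho * A"
    and "0 < rho * I1" "0 < rho * I2" "0 < rho * I3"
    and "GG = diag3 (G * A) (G * A) (E * A)"
    and "HH = diag3 (E * I1) (E * I2) (G * I3)"
    and "AA = mat (rho * A)"
    and "JJ = rho *\<^sub>R diag3 I1 I2 I3"
    and "smooth_on ({0..L} \<times> {t1..t2}) phi"
    and "smooth_on ({0..L} \<times> {t1..t2}) R"
    and "\<forall>p\<in>{0..L} \<times> {t1..t2}. rotation_matrix (R p)"
  shows "hamilton_principle L t1 t2 GG HH AA JJ phi R \<longleftrightarrow>
    (\<forall>p\<in>{0..L} \<times> {t1..t2}.
       partial_S L (stress L GG phi R) p = partial_t t1 t2 (linear_momentum t1 t2 AA phi R) p \<and>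
       partial_S L (couple L HH R) p + cross3 (partial_S L phi p) (stress L GG phi R p)
         = partial_t t1 t2 (angular_momentum t1 t2 JJ R) p)"
proof -
  let ?D = "{0..L} \<times> {t1..t2}"
  have sym: "x \<bullet> (GG *v y) = (GG *v x) \<bullet> y" "x \<bullet> (HH *v y) = (HH *v x) \<bullet> y"
    "x \<bullet> (JJ *v y) = (JJ *v x) \<bullet> y" for x y
    by (simp_all add: assms inner_diag3 flip: scaleR_matrix_vector_assoc)
  have "hamilton_principle L t1 t2 GG HH AA JJ phi R \<longleftrightarrow>
    (\<forall>p\<in>?D. force_defect L t1 t2 GG AA phi R p = 0 \<and> moment_defect L t1 t2 GG HH JJ phi R p = 0)"
  proof
    assume "hamilton_principle L t1 t2 GG HH AA JJ phi R"
    then show "\<forall>p\<in>?D. force_defect L t1 t2 GG AA phi R p = 0 \<and> moment_defect L t1 t2 GG HH JJ phi R p = 0"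
      using hamilton_imp_force_defect_0[OF assms(1,2) sym assms(16,17)]
        hamilton_imp_moment_defect_0[OF assms(1,2) sym assms(16,17)] assms(18)
      unfolding \<open>AA = _\<close> by blast
  next
    \<comment> \<open>Conversely, vanishing defects make the integrand of the first variation zero
      for every admissible variation.\<close>
    assume *: "\<forall>p\<in>?D. force_defect L t1 t2 GG AA phi R p = 0 \<and> moment_defect L t1 t2 GG HH JJ phi R p = 0"
    show "hamilton_principle L t1 t2 GG HH AA JJ phi R"
      unfolding hamilton_principle_def
    proof (intro allI impI)
      fix a Phi Q
      assume v: "smooth_family L t1 t2 a phi R Phi Q" "admissible_variation L t1 t2 GG HH phi R Phi Q"
      have "integral (cbox (0, t1) (L, t2)) (\<lambda>p. delta Phi p \<bullet> force_defect L t1 t2 GG AA phi R p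
          + delta_theta R Q p \<bullet> moment_defect L t1 t2 GG HH JJ phi R p) = integral (cbox (0, t1) (L, t2)) (\<lambda>p. 0)"
      proof (rule integral_cong)
        fix p assume "p \<in> cbox (0, t1) (L, t2)"
        then have "p \<in> ?D" by (simp add: cbox_Pair_eq)
        with * have "force_defect L t1 t2 GG AA phi R p = 0" "moment_defect L t1 t2 GG HH JJ phi R p = 0"
          by blast+
        then show "delta Phi p \<bullet> force_defect L t1 t2 GG AA phi R p
          + delta_theta R Q p \<bullet> moment_defect L t1 t2 GG HH JJ phi R p = 0" by simp
      qed
      then show "((\<lambda>nu. action L t1 t2 GG HH AA JJ (Phi nu) (Q nu)) has_real_derivative 0) (at 0)"
        using action_has_derivative[OF assms(1,2) sym v, of "rho * A"] \<open>AA = _\<close> by simp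
    qed
  qed
  then show ?thesis by (simp add: force_defect_def moment_defect_def)
qed

end
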